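(* Let $J\subset\mathbb{R}$ be a bounded open interval. If $q$ is defined by a complex Radon measure $\mu$ on $\overline{J}$, that is, $(q|\phi)=\int_J\phi\,d\mu$ for all $\phi\in W_0^{1,2}(J)$, then $q$ is admissible.
   Context: All functions are complex-valued. $W^{-1,2}(J)$ is the topological dual of $W^{1,2}_0(J)$, with (bilinear) action $(q|\phi)$. For $q\in W^{-1,2}(J)$ and $y\in W^{1,2}(J)$, $\mathbf{S}_qy=-y''+qy\in W^{-1,2}(J)$ is defined by $(\mathbf{S}_qy|\phi)=\int_Jy'\phi'\,dx+(q|y\phi)$, $\phi\in W_0^{1,2}(J)$. $\mathscr{D}_2(\mathbf{S}_q)$ is the set of $y\in W^{1,2}(J)$ such that $\mathbf{S}_qy$ is given by an $L^2(J)$ function $g$, i.e. $(\mathbf{S}_qy|\phi)=\int_Jg\phi\,dx$ for all $\phi$. A potential $q$ is admissible if $q\in W^{-1,2}(J)$ and there exists $f\in\mathscr{D}_2(\mathbf{S}_q)$ with $\mathbf{S}_qf=0$ and $f(x)\neq0$ for all $x\in\overline{J}$. *)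

theory Defs
  imports "HOL-Analysis.Analysis"
begin

definition L2 :: "real set \<Rightarrow> (real \<Rightarrow> complex) set" where
  "L2 J = {g. g \<in> borel_measurable (lebesgue_on J) \<and>
              integrable (lebesgue_on J) (\<lambda>x. (cmod (g x))\<^sup>2)}"

definition smooth :: "(real \<Rightarrow> complex) \<Rightarrow> bool" where
  "smooth \<phi> \<longleftrightarrow>
     (\<forall>n x. ((\<lambda>h t. vector_derivative h (at t)) ^^ n) \<phi> differentiable (at x))"

definition test_functions :: "real set \<Rightarrow> (real \<Rightarrow> complex) set" where
  "test_functions J =
     {\<phi>. smooth \<phi> \<and> compact (closure {x. \<phi> x \<noteq> 0}) \<and> closure {x. \<phi> x \<noteq> 0} \<subseteq> J}"

definition has_weak_deriv :: "real set \<Rightarrow> (real \<Rightarrow> complex) \<Rightarrow> (real \<Rightarrow> complex) \<Rightarrow> bool" where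
  "has_weak_deriv J y g \<longleftrightarrow>
     (\<forall>\<phi>\<in>test_functions J.
        (LINT x|lebesgue_on J. y x * vector_derivative \<phi> (at x)) =
        - (LINT x|lebesgue_on J. g x * \<phi> x))"

text \<open>For a bounded open interval \<open>J\<close>, every class in the Sobolev space \<open>W\<^sup>1\<^sup>,\<^sup>2(J)\<close> has a unique
  representative that extends continuously to \<open>closure J\<close>. Elements of the space are taken to be
  functions agreeing with this representative on \<open>closure J\<close>, so that pointwise values there make
  sense; values outside \<open>closure J\<close> are irrelevant.\<close>

definition W12 :: "real set \<Rightarrow> (real \<Rightarrow> complex) set" where
  "W12 J = {y. continuous_on (closure J) y \<and> y \<in> L2 J \<and> (\<exists>g\<in>L2 J. has_weak_deriv J y g)}"

text \<open>Unique up to null sets for \<open>y\<close> in \<open>W12 J\<close>.\<close>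

definition weak_deriv :: "real set \<Rightarrow> (real \<Rightarrow> complex) \<Rightarrow> real \<Rightarrow> complex" where
  "weak_deriv J y = (SOME g. g \<in> L2 J \<and> has_weak_deriv J y g)"

definition W12_norm :: "real set \<Rightarrow> (real \<Rightarrow> complex) \<Rightarrow> real" where
  "W12_norm J y =
     sqrt ((LINT x|lebesgue_on J. (cmod (y x))\<^sup>2) +
           (LINT x|lebesgue_on J. (cmod (weak_deriv J y x))\<^sup>2))"

text \<open>The closure of the test functions in \<open>W12 J\<close>.\<close>

definition W12_0 :: "real set \<Rightarrow> (real \<Rightarrow> complex) set" where
  "W12_0 J = {y \<in> W12 J. \<exists>\<phi>. (\<forall>n::nat. \<phi> n \<in> test_functions J) \<and>
                (\<lambda>n. W12_norm J (\<lambda>x. y x - \<phi> n x)) \<longlonglongrightarrow> 0}"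

text \<open>Bounded linear functionals on \<open>W12_0 J\<close>, with \<open>(q|\<phi>)\<close> written \<open>q \<phi>\<close>; the value of \<open>q\<close> off
  \<open>W12_0 J\<close> is irrelevant. Boundedness and linearity make \<open>q\<close> independent of the choice of
  representatives.\<close>

definition W12_dual :: "real set \<Rightarrow> ((real \<Rightarrow> complex) \<Rightarrow> complex) set" where
  "W12_dual J = {q.
     (\<forall>\<phi>\<in>W12_0 J. \<forall>\<psi>\<in>W12_0 J. q (\<lambda>x. \<phi> x + \<psi> x) = q \<phi> + q \<psi>) \<and>
     (\<forall>c. \<forall>\<phi>\<in>W12_0 J. q (\<lambda>x. c * \<phi> x) = c * q \<phi>) \<and>
     (\<exists>C. \<forall>\<phi>\<in>W12_0 J. cmod (q \<phi>) \<le> C * W12_norm J \<phi>)}"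

definition S_op :: "real set \<Rightarrow> ((real \<Rightarrow> complex) \<Rightarrow> complex) \<Rightarrow>
    (real \<Rightarrow> complex) \<Rightarrow> (real \<Rightarrow> complex) \<Rightarrow> complex" where
  "S_op J q y \<phi> =
     (LINT x|lebesgue_on J. weak_deriv J y x * weak_deriv J \<phi> x) + q (\<lambda>x. y x * \<phi> x)"

definition D2 :: "real set \<Rightarrow> ((real \<Rightarrow> complex) \<Rightarrow> complex) \<Rightarrow> (real \<Rightarrow> complex) set" where
  "D2 J q = {y \<in> W12 J. \<exists>g\<in>L2 J. \<forall>\<phi>\<in>W12_0 J.
               S_op J q y \<phi> = (LINT x|lebesgue_on J. g x * \<phi> x)}"

definition admissible :: "real set \<Rightarrow> ((real \<Rightarrow> complex) \<Rightarrow> complex) \<Rightarrow> bool" where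
  "admissible J q \<longleftrightarrow> q \<in> W12_dual J \<and>
     (\<exists>f\<in>D2 J q. (\<forall>\<phi>\<in>W12_0 J. S_op J q f \<phi> = 0) \<and> (\<forall>x\<in>closure J. f x \<noteq> 0))"

text \<open>A complex Borel measure on \<open>X\<close> is a countably additive complex set function (whence
  \<open>\<mu> {} = 0\<close>). On a compact set it is finite and automatically regular, so complex Radon measures on
  a compact \<open>X\<close> are exactly these.\<close>

definition complex_borel_measure :: "real set \<Rightarrow> (real set \<Rightarrow> complex) \<Rightarrow> bool" where
  "complex_borel_measure X \<mu> \<longleftrightarrow>
     (\<forall>A :: nat \<Rightarrow> real set. range A \<subseteq> sets (restrict_space borel X) \<longrightarrow> disjoint_family A \<longrightarrow>
        (\<lambda>n. \<mu> (A n)) sums \<mu> (\<Union>n. A n))"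

text \<open>The positive part \<open>s\<^sup>+\<close> in the Jordan decomposition of a signed Borel measure \<open>s\<close> on \<open>X\<close>; the
  negative part is the positive part of \<open>-s\<close>. Negative \<open>s B\<close> are truncated to \<open>0 = s {}\<close>.\<close>

definition pos_variation :: "real set \<Rightarrow> (real set \<Rightarrow> real) \<Rightarrow> real measure" where
  "pos_variation X s = measure_of X (sets (restrict_space borel X))
     (\<lambda>A. SUP B\<in>{B \<in> sets (restrict_space borel X). B \<subseteq> A}. ennreal (s B))"

text \<open>The integral of \<open>\<phi>\<close> over \<open>A \<subseteq> X\<close> with respect to a complex Borel measure on \<open>X\<close>.\<close>

definition complex_measure_integral ::
    "real set \<Rightarrow> (real set \<Rightarrow> complex) \<Rightarrow> real set \<Rightarrow> (real \<Rightarrow> complex) \<Rightarrow> complex" where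
  "complex_measure_integral X \<mu> A \<phi> =
     (LINT x:A|pos_variation X (\<lambda>B. Re (\<mu> B)). \<phi> x) -
     (LINT x:A|pos_variation X (\<lambda>B. - Re (\<mu> B)). \<phi> x) +
     \<i> * ((LINT x:A|pos_variation X (\<lambda>B. Im (\<mu> B)). \<phi> x) -
          (LINT x:A|pos_variation X (\<lambda>B. - Im (\<mu> B)). \<phi> x))"

end

theory Submission
  imports Defs
begin

text \<open>The functional \<open>q\<close> only involves \<open>\<mu>\<close> through the four positive variations, which are finite
  measures, so \<open>S\<^sub>q f = 0\<close> follows from the integral equation
  \<open>f(x) = \<alpha> + \<beta> (x - a) + \<integral> (x - s)\<^sup>+ f(s) d\<mu>(s)\<close>. Its kernel is Lipschitz in \<open>x\<close>, so atoms of \<open>\<mu>\<close>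
  do no harm: solutions exist for all \<open>\<alpha>, \<beta>\<close> and are Lipschitz, and vanishing Cauchy data at one point
  force \<open>\<alpha> = \<beta> = 0\<close>. Hence the solutions \<open>f, g\<close> with data \<open>(1, 0)\<close> and \<open>(0, 1)\<close> have no common
  zero. The image of \<open>- f / g\<close> is a locally Lipschitz curve, which is a null set in the plane; for \<open>\<beta>\<close>
  outside it, \<open>f + \<beta> g\<close> has no zero on the closed interval.\<close>

section \<open>Smooth functions and test functions\<close>

text \<open>The equation says f'' = f mu, so f' jumps at atoms and only its integrated form is
  usable. \<open>quasi_deriv\<close> is f' defined at every point, with the mass at the point itself
  left out. All integrations by parts are exchanges of integrals over a triangle t < s. They need
  the functions in W_0^{1,2} to be exactly the primitives of L^2 functions of mean zero, and this is
  what the density of test functions provides. The parameters \<alpha>, \<beta> are the Cauchy data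
  at the left end, so a solution with vanishing data at x only has to be followed to the left of x.
  On that side the left-out mass is the right convention: neither an atom at x nor anything beyond
  it enters. Applied to linear combinations of f and g, this does the work of a nonvanishing
  Wronskian.\<close>

primrec times_differentiable :: "nat \<Rightarrow> (real \<Rightarrow> complex) \<Rightarrow> bool" where
  "times_differentiable 0 f = True"
| "times_differentiable (Suc n) f =
     (\<exists>f'. (\<forall>x. (f has_vector_derivative f' x) (at x)) \<and> times_differentiable n f')"

lemma times_differentiable_SucD: "times_differentiable (Suc n) f \<Longrightarrow> times_differentiable n f"
proof (induction n arbitrary: f)
  case (Suc n)
  then show ?case by (metis times_differentiable.simps(2))
qed simp

lemma times_differentiable_iterate:
  "times_differentiable (n + m) f \<Longrightarrow>
   times_differentiable m (((\<lambda>h t. vector_derivative h (at t)) ^^ n) f)"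
proof (induction n arbitrary: f)
  case (Suc n)
  then obtain f' where f': "\<And>x. (f has_vector_derivative f' x) (at x)"
    "times_differentiable (n + m) f'" by auto
  have "(\<lambda>t. vector_derivative f (at t)) = f'"
    using f'(1) by (auto simp: fun_eq_iff intro: vector_derivative_at)
  then show ?case using Suc.IH[OF f'(2)] by (simp add: funpow_Suc_right del: funpow.simps)
qed simp

text \<open>\<open>smooth\<close> iterates \<open>vector_derivative\<close>, which is awkward for
  sums and products. In \<open>times_differentiable\<close> each derivative is an existential
  witness, so inductions can supply explicit formulas. Uniqueness of derivatives makes the two
  notions agree.\<close>

lemma smooth_iff: "smooth f \<longleftrightarrow> (\<forall>n. times_differentiable n f)"
proof
  assume R: "\<forall>n. times_differentiable n f"
  have "((\<lambda>h t. vector_derivative h (at t)) ^^ n) f differentiable (at x)" for n x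
    using times_differentiable_iterate[of n 1 f] R
    by (auto simp: differentiable_def has_vector_derivative_def)
  then show "smooth f" by (simp add: smooth_def)
next
  assume L: "smooth f"
  have "times_differentiable n (((\<lambda>h t. vector_derivative h (at t)) ^^ m) f)" for n m
  proof (induction n arbitrary: m)
    case (Suc n)
    let ?h = "((\<lambda>h t. vector_derivative h (at t)) ^^ m) f"
    have "(?h has_vector_derivative vector_derivative ?h (at x)) (at x)" for x
      using L by (simp add: smooth_def vector_derivative_works[symmetric])
    then show ?case using Suc[of "Suc m"]
      by (auto intro!: exI[of _ "\<lambda>x. vector_derivative ?h (at x)"])
  qed simp
  from this[of _ 0] show "\<forall>n. times_differentiable n f" by simp
qed

text \<open>Smoothness is proved by exhibiting a class \<open>P\<close> closed under
  differentiation, such as constants, polynomial functions or the functions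
  \<open>flat_exp p\<close>.\<close>

lemma smooth_coinduct:
  assumes "P f" and step: "\<And>f. P f \<Longrightarrow> \<exists>f'. (\<forall>x. (f has_vector_derivative f' x) (at x)) \<and> P f'"
  shows "smooth f"
proof -
  have "times_differentiable n f" if "P f" for n f
    using that
  proof (induction n arbitrary: f)
    case (Suc n)
    from step[OF Suc.prems] Suc.IH show ?case by auto
  qed simp
  with assms(1) show ?thesis by (simp add: smooth_iff)
qed

lemma smoothE:
  assumes "smooth f"
  shows "(f has_vector_derivative vector_derivative f (at x)) (at x)"
    and "smooth (\<lambda>x. vector_derivative f (at x))"
proof -
  have d: "\<exists>f'. (\<forall>x. (f has_vector_derivative f' x) (at x)) \<and> times_differentiable n f'" for n
    using assms smooth_iff times_differentiable.simps(2) by blast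
  then show "(f has_vector_derivative vector_derivative f (at x)) (at x)" 
    by (metis vector_derivative_at)
  \<comment> \<open>The witness \<open>f'\<close> may depend on \<open>n\<close>, but each one
    equals \<open>vector_derivative f\<close>.\<close>
  have "times_differentiable n (\<lambda>x. vector_derivative f (at x))" for n
  proof -
    obtain f' where f': "\<And>x. (f has_vector_derivative f' x) (at x)" "times_differentiable n f'"
      using d by blast
    have "(\<lambda>x. vector_derivative f (at x)) = f'"
      using f'(1) by (auto simp: fun_eq_iff intro: vector_derivative_at)
    then show ?thesis using f' by simp
  qed
  then show "smooth (\<lambda>x. vector_derivative f (at x))" by (simp add: smooth_iff)
qed

lemma smooth_integrate:
  assumes "\<And>x. (f has_vector_derivative f' x) (at x)" "smooth f'"
  shows "smooth f"
  unfolding smooth_iff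
proof
  fix n show "times_differentiable n f"
    using assms times_differentiable_SucD smooth_iff by (metis times_differentiable.simps(2))
qed

lemma smooth_continuous: "smooth f \<Longrightarrow> continuous_on S f"
  by (meson continuous_on_eq_continuous_within continuous_at_imp_continuous_on
      has_vector_derivative_continuous smoothE(1))

lemma times_differentiable_add:
  "times_differentiable n f \<Longrightarrow> times_differentiable n g \<Longrightarrow> times_differentiable n (\<lambda>x. f x + g x)"
proof (induction n arbitrary: f g)
  case (Suc n)
  obtain f' g' where d: "\<And>x. (f has_vector_derivative f' x) (at x)" "times_differentiable n f'"
    "\<And>x. (g has_vector_derivative g' x) (at x)" "times_differentiable n g'"
    using Suc.prems by auto
  have "((\<lambda>x. f x + g x) has_vector_derivative (f' x + g' x)) (at x)" for x
    by (intro has_vector_derivative_add d)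
  then show ?case using Suc.IH[OF d(2,4)]
    by (auto intro!: exI[of _ "\<lambda>x. f' x + g' x"])
qed simp

lemma smooth_add: "smooth f \<Longrightarrow> smooth g \<Longrightarrow> smooth (\<lambda>x. f x + g x)"
  by (simp add: smooth_iff times_differentiable_add)

lemma smooth_mult: "smooth f \<Longrightarrow> smooth g \<Longrightarrow> smooth (\<lambda>x. f x * g x)"
proof -
  have "times_differentiable n (\<lambda>x. f x * g x)"
    if "times_differentiable n f" "times_differentiable n g" for n f g
    using that
  proof (induction n arbitrary: f g)
    case (Suc n)
    obtain f' g' where d: "\<forall>x. (f has_vector_derivative f' x) (at x)" "times_differentiable n f'"
      "\<forall>x. (g has_vector_derivative g' x) (at x)" "times_differentiable n g'"
      using Suc.prems by auto
    have "\<forall>x. ((\<lambda>x. f x * g x) has_vector_derivative (f x * g' x + f' x * g x)) (at x)"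
      using d has_vector_derivative_mult by blast
    moreover have "times_differentiable n (\<lambda>x. f x * g' x + f' x * g x)"
      using d Suc.IH Suc.prems times_differentiable_SucD by (intro times_differentiable_add) auto
    ultimately show ?case by (auto intro!: exI[of _ "\<lambda>x. f x * g' x + f' x * g x"])
  qed simp
  then show "smooth f \<Longrightarrow> smooth g \<Longrightarrow> ?thesis" by (simp add: smooth_iff)
qed

lemma smooth_const: "smooth (\<lambda>x. c)"
  by (rule smooth_coinduct[of "\<lambda>f. \<exists>c. f = (\<lambda>x. c)"])
     (auto intro!: exI[of _ "\<lambda>x. 0"] derivative_eq_intros)

lemma smooth_polynomial_function: "polynomial_function p \<Longrightarrow> smooth p"
  by (rule smooth_coinduct[of polynomial_function]) (metis has_vector_derivative_polynomial_function)+

section \<open>Flat functions p(1/y) exp(-1/y), extended by zero\<close>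

definition flat_exp :: "real poly \<Rightarrow> real \<Rightarrow> real" where
  "flat_exp p y = (if y > 0 then poly p (inverse y) * exp (- inverse y) else 0)"

lemma poly_div_exp_tendsto_0: "((\<lambda>t. poly p t * exp (- t)) \<longlongrightarrow> (0::real)) at_top"
proof -
  have "((\<lambda>t. \<Sum>i\<le>degree p. coeff p i * (t ^ i / exp t)) \<longlongrightarrow> (\<Sum>i\<le>degree p. coeff p i * 0)) at_top"
    by (intro tendsto_intros tendsto_power_div_exp_0)
  then show ?thesis
    by (simp add: poly_altdef exp_minus field_simps sum_divide_distrib)
qed

text \<open>For y > 0 the derivative of p(1/y) exp(-1/y) is (p - p')(1/y) exp(-1/y) / y^2, again of
  the same form. The polynomial parameter is there to make the family closed under
  differentiation.\<close>

lemma flat_exp_deriv: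
  "(flat_exp p has_real_derivative flat_exp (monom 1 2 * (p - pderiv p)) y) (at y)"
proof -
  consider "y > 0" | "y < 0" | "y = 0" by linarith
  then show ?thesis
  proof cases
    case 1
    have "((\<lambda>y. poly p (inverse y) * exp (- inverse y)) has_real_derivative
        flat_exp (monom 1 2 * (p - pderiv p)) y) (at y)"
      using 1 by (auto intro!: derivative_eq_intros
          simp: flat_exp_def poly_monom field_simps power2_eq_square)
    then show ?thesis
      by (rule has_field_derivative_transform_within_open[of _ _ _ "{0<..}"])
         (use 1 in \<open>auto simp: flat_exp_def\<close>)
  next
    case 2
    have "((\<lambda>y. 0) has_real_derivative flat_exp (monom 1 2 * (p - pderiv p)) y) (at y)"
      using 2 by (auto simp: flat_exp_def)
    then show ?thesis
      by (rule has_field_derivative_transform_within_open[of _ _ _ "{..<0}"])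
         (use 2 in \<open>auto simp: flat_exp_def\<close>)
  next
    case 3
    \<comment> \<open>With t = 1/h the difference quotient at 0 is t p(t) exp(-t), whence the factor
      \<open>monom 1 1\<close>.\<close>
    have "((\<lambda>h. flat_exp p h / h) \<longlongrightarrow> 0) (at_right 0)"
    proof -
      have "((\<lambda>h. poly (monom 1 1 * p) (inverse h) * exp (- inverse h)) \<longlongrightarrow> (0::real)) (at_right 0)"
        by (rule filterlim_compose[OF poly_div_exp_tendsto_0 filterlim_inverse_at_top_right])
      then show ?thesis
        by (rule Lim_transform_eventually)
           (auto simp: eventually_at_filter flat_exp_def poly_monom field_simps)
    qed
    moreover have "((\<lambda>h. flat_exp p h / h) \<longlongrightarrow> 0) (at_left 0)"
      by (rule Lim_transform_eventually[OF tendsto_const])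
         (auto simp: eventually_at_filter flat_exp_def)
    ultimately have "((\<lambda>h. flat_exp p h / h) \<longlongrightarrow> 0) (at 0)"
      by (simp add: filterlim_split_at)
    then show ?thesis using 3
      by (simp add: DERIV_def flat_exp_def)
  qed
qed

text \<open>The affine argument serves the slopes n and -n of the cutoffs. The factor
  \<open>m\<close> of the chain rule is absorbed into the polynomial.\<close>

lemma smooth_flat_exp: "smooth (\<lambda>x. of_real (flat_exp p (m * x + c)))"
proof (rule smooth_coinduct[of "\<lambda>f. \<exists>p. f = (\<lambda>x. of_real (flat_exp p (m * x + c)))"])
  fix f assume "\<exists>p. f = (\<lambda>x. complex_of_real (flat_exp p (m * x + c)))"
  then obtain p where f: "f = (\<lambda>x. of_real (flat_exp p (m * x + c)))" by blast
  let ?q = "smult m (monom 1 2 * (p - pderiv p))"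
  have "((\<lambda>x. flat_exp p (m * x + c)) has_real_derivative flat_exp ?q (m * x + c)) (at x)" for x
  proof -
    have "((\<lambda>x. flat_exp p (m * x + c)) has_real_derivative
        flat_exp (monom 1 2 * (p - pderiv p)) (m * x + c) * m) (at x)"
      by (rule DERIV_chain2[OF flat_exp_deriv]) (auto intro!: derivative_eq_intros)
    then show ?thesis by (simp add: flat_exp_def algebra_simps split: if_splits)
  qed
  then have "\<forall>x. (f has_vector_derivative of_real (flat_exp ?q (m * x + c))) (at x)"
    unfolding f using has_vector_derivative_of_real by blast
  then show "\<exists>f'. (\<forall>x. (f has_vector_derivative f' x) (at x)) \<and>
      (\<exists>p. f' = (\<lambda>x. complex_of_real (flat_exp p (m * x + c))))"
    by (intro exI[of _ "\<lambda>x. of_real (flat_exp ?q (m * x + c))"] conjI exI[of _ ?q]) auto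
qed blast

section \<open>Test functions on a bounded interval\<close>

lemma test_functionI:
  assumes "smooth \<phi>" "a < c" "d < b" "\<And>x. \<phi> x \<noteq> 0 \<Longrightarrow> c \<le> x \<and> x \<le> d"
  shows "\<phi> \<in> test_functions {a<..<b}"
proof -
  have *: "closure {x. \<phi> x \<noteq> 0} \<subseteq> {c..d}"
    using assms(4) by (intro closure_minimal) auto
  moreover have "{c..d} \<subseteq> {a<..<b}" using assms by auto
  moreover have "compact (closure {x. \<phi> x \<noteq> 0})"
    using bounded_subset[OF bounded_closed_interval *] by (simp add: compact_eq_bounded_closed)
  ultimately show ?thesis using assms(1) by (auto simp: test_functions_def)
qed

lemma test_functionE:
  fixes a b :: real
  assumes "\<phi> \<in> test_functions {a<..<b}" "a < b"
  obtains c d where "smooth \<phi>" "a < c" "c \<le> d" "d < b" "\<And>x. \<phi> x \<noteq> 0 \<Longrightarrow> c \<le> x \<and> x \<le> d"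
proof -
  let ?K = "closure {x. \<phi> x \<noteq> 0}"
  have K: "smooth \<phi>" "compact ?K" "?K \<subseteq> {a<..<b}" using assms by (auto simp: test_functions_def)
  show ?thesis
  proof (cases "?K = {}")
    case True
    then have "{x. \<phi> x \<noteq> 0} = {}" by (metis closure_eq_empty)
    then show ?thesis using that[of "(a+b)/2" "(a+b)/2"] K assms(2) by auto
  next
    case False
    obtain c where c: "c \<in> ?K" "\<And>x. x \<in> ?K \<Longrightarrow> c \<le> x"
      using compact_attains_inf[OF K(2) False] by blast
    obtain d where d: "d \<in> ?K" "\<And>x. x \<in> ?K \<Longrightarrow> x \<le> d"
      using compact_attains_sup[OF K(2) False] by blast
    have "x \<in> ?K" if "\<phi> x \<noteq> 0" for x
      by (rule subsetD[OF closure_subset]) (simp add: that)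
    then show ?thesis using that[of c d] c d subsetD[OF K(3) c(1)] subsetD[OF K(3) d(1)] K(1) by auto
  qed
qed

lemma test_function_outside:
  fixes a b :: real
  assumes "\<phi> \<in> test_functions {a<..<b}" "a < b" "x \<notin> {a<..<b}"
  shows "\<phi> x = 0"
proof (rule ccontr)
  assume "\<phi> x \<noteq> 0"
  then have "x \<in> closure {x. \<phi> x \<noteq> 0}" by (intro subsetD[OF closure_subset]) simp
  then show False using assms by (auto simp: test_functions_def)
qed

lemma test_function_deriv:
  fixes a b :: real
  assumes "\<phi> \<in> test_functions {a<..<b}" "a < b"
  shows "(\<lambda>x. vector_derivative \<phi> (at x)) \<in> test_functions {a<..<b}"
proof -
  obtain c d where cd: "smooth \<phi>" "a < c" "c \<le> d" "d < b" "\<And>x. \<phi> x \<noteq> 0 \<Longrightarrow> c \<le> x \<and> x \<le> d"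
    using test_functionE[OF assms] by blast
  have "vector_derivative \<phi> (at x) = 0" if "\<not> (c \<le> x \<and> x \<le> d)" for x
  proof -
    have "((\<lambda>x. 0) has_vector_derivative 0) (at x)" by simp
    then have "(\<phi> has_vector_derivative 0) (at x)"
      by (rule has_vector_derivative_transform_within_open[of _ _ _ "- {c..d}"])
         (use cd(5) that in \<open>auto\<close>)
    then show ?thesis by (rule vector_derivative_at)
  qed
  then show ?thesis
    using smoothE(2)[OF cd(1)] cd by (intro test_functionI[of _ a c d b]) auto
qed

lemma test_function_add:
  fixes a b :: real
  assumes "\<phi> \<in> test_functions {a<..<b}" "\<psi> \<in> test_functions {a<..<b}" "a < b"
  shows "(\<lambda>x. \<phi> x + \<psi> x) \<in> test_functions {a<..<b}"
proof -
  obtain c d where cd: "smooth \<phi>" "a < c" "c \<le> d" "d < b" "\<And>x. \<phi> x \<noteq> 0 \<Longrightarrow> c \<le> x \<and> x \<le> d"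
    using test_functionE[OF assms(1,3)] by blast
  obtain c' d' where cd': "smooth \<psi>" "a < c'" "c' \<le> d'" "d' < b" "\<And>x. \<psi> x \<noteq> 0 \<Longrightarrow> c' \<le> x \<and> x \<le> d'"
    using test_functionE[OF assms(2,3)] by blast
  show ?thesis
  proof (rule test_functionI[of _ a "min c c'" "max d d'" b])
    fix x assume "\<phi> x + \<psi> x \<noteq> 0"
    then have "\<phi> x \<noteq> 0 \<or> \<psi> x \<noteq> 0" by auto
    then show "min c c' \<le> x \<and> x \<le> max d d'" using cd(5)[of x] cd'(5)[of x] by auto
  qed (use cd cd' smooth_add in auto)
qed

lemma test_function_smooth_mult:
  fixes a b :: real
  assumes "\<phi> \<in> test_functions {a<..<b}" "smooth \<psi>" "a < b"
  shows "(\<lambda>x. \<psi> x * \<phi> x) \<in> test_functions {a<..<b}"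
proof -
  obtain c d where cd: "smooth \<phi>" "a < c" "c \<le> d" "d < b" "\<And>x. \<phi> x \<noteq> 0 \<Longrightarrow> c \<le> x \<and> x \<le> d"
    using test_functionE[OF assms(1,3)] by blast
  show ?thesis
    by (rule test_functionI[of _ a c d b]) (use cd assms smooth_mult in auto)
qed

text \<open>The shifts by 1 make the support lie between a + 1/n and b - 1/n. For fixed x inside the
  interval both arguments grow without bound, and \<open>flat_exp 1\<close> tends to exp 0 = 1
  there.\<close>

definition cutoff :: "real \<Rightarrow> real \<Rightarrow> nat \<Rightarrow> real \<Rightarrow> real" where
  "cutoff a b n x = flat_exp 1 (real n * (x - a) - 1) * flat_exp 1 (real n * (b - x) - 1)"

lemma cutoff_nonneg: "0 \<le> cutoff a b n x" and cutoff_le_1: "cutoff a b n x \<le> 1"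
  by (auto simp: cutoff_def flat_exp_def intro!: mult_le_one)

lemma cutoff_test_function:
  assumes "a < b"
  shows "(\<lambda>x. of_real (cutoff a b n x)) \<in> test_functions {a<..<b}"
proof (cases "n = 0")
  case True
  then have "(\<lambda>x. complex_of_real (cutoff a b n x)) = (\<lambda>x. 0)" by (simp add: cutoff_def flat_exp_def)
  \<comment> \<open>The function is zero, so the empty interval from b to a can serve as its support
    bound.\<close>
  then show ?thesis using assms smooth_const by (auto intro!: test_functionI[of _ a b a b] simp: )
next
  case False
  have 1: "smooth (\<lambda>x. complex_of_real (flat_exp 1 (real n * (x - a) - 1)))"
    using smooth_flat_exp[of 1 "real n" "- real n * a - 1"] by (simp add: algebra_simps)
  have 2: "smooth (\<lambda>x. complex_of_real (flat_exp 1 (real n * (b - x) - 1)))"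
    using smooth_flat_exp[of 1 "- real n" "real n * b - 1"] by (simp add: algebra_simps)
  show ?thesis
  proof (rule test_functionI[of _ a "a + 1 / n" "b - 1 / n"])
    show "smooth (\<lambda>x. complex_of_real (cutoff a b n x))"
      using smooth_mult[OF 1 2] by (simp add: cutoff_def)
    show "a < a + 1 / n" "b - 1 / n < b" using False by auto
    fix x assume "complex_of_real (cutoff a b n x) \<noteq> 0"
    then have "real n * (x - a) > 1" "real n * (b - x) > 1"
      by (auto simp: cutoff_def flat_exp_def split: if_splits)
    then show "a + 1 / n \<le> x \<and> x \<le> b - 1 / n" using False by (auto simp: field_simps)
  qed
qed

lemma cutoff_tendsto_1:
  assumes "x \<in> {a<..<b}"
  shows "(\<lambda>n. cutoff a b n x) \<longlonglongrightarrow> 1"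
proof -
  have *: "(\<lambda>n. flat_exp 1 (real n * c - 1)) \<longlonglongrightarrow> 1" if "c > 0" for c
  proof -
    have lim: "filterlim (\<lambda>n. real n * c - 1) at_top sequentially" 
      using filterlim_tendsto_add_at_top[OF tendsto_const[of "-1"] filterlim_at_top_mult_tendsto_pos[OF tendsto_const that filterlim_real_sequentially]]
      by (simp add: algebra_simps)
    have "(\<lambda>n. exp (- inverse (real n * c - 1))) \<longlonglongrightarrow> exp (- 0)"
      by (intro tendsto_intros tendsto_inverse_0_at_top lim)
    moreover have "\<forall>\<^sub>F n in sequentially. exp (- inverse (real n * c - 1)) = flat_exp 1 (real n * c - 1)"
      using eventually_compose_filterlim[OF eventually_gt_at_top[of 0] lim]
      by eventually_elim (simp add: flat_exp_def)
    ultimately show ?thesis by (simp add: Lim_transform_eventually)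
  qed
  show ?thesis using tendsto_mult[OF *[of "x - a"] *[of "b - x"]] assms by (simp add: cutoff_def)
qed

section \<open>Density of test functions in \<open>L\<^sup>2\<close>\<close>

text \<open>The squared L^2 norm. Its triangle inequality carries a factor 2, which is harmless for
  limits and explains the constants in the estimates below.\<close>

definition sqint :: "real set \<Rightarrow> (real \<Rightarrow> complex) \<Rightarrow> real" where
  "sqint J F = (LINT x|lebesgue_on J. (cmod (F x))\<^sup>2)"

lemma sqint_nonneg: "0 \<le> sqint J F"
  by (simp add: sqint_def)

lemma square_norm_add_le: "(cmod (x + y))\<^sup>2 \<le> 2 * (cmod x)\<^sup>2 + 2 * (cmod y)\<^sup>2"
proof -
  have "(cmod (x + y))\<^sup>2 \<le> (cmod x + cmod y)\<^sup>2"
    by (simp add: norm_triangle_ineq power_mono)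
  also have "\<dots> \<le> 2 * (cmod x)\<^sup>2 + 2 * (cmod y)\<^sup>2"
    using zero_le_power2[of "cmod x - cmod y"] by (simp add: power2_eq_square algebra_simps)
  finally show ?thesis .
qed

lemma mult_le_half_squares: "(x::real) * y \<le> (x\<^sup>2 + y\<^sup>2) / 2"
  using zero_le_power2[of "x - y"] by (simp add: power2_eq_square algebra_simps)

lemma L2_measurable: "F \<in> L2 J \<Longrightarrow> F \<in> borel_measurable (lebesgue_on J)"
  by (simp add: L2_def)

lemma L2_integrable_square: "F \<in> L2 J \<Longrightarrow> integrable (lebesgue_on J) (\<lambda>x. (cmod (F x))\<^sup>2)"
  by (simp add: L2_def)

lemma L2_add:
  assumes "F \<in> L2 J" "G \<in> L2 J"
  shows "(\<lambda>x. F x + G x) \<in> L2 J"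
proof -
  note [measurable] = assms[THEN L2_measurable]
  have "integrable (lebesgue_on J) (\<lambda>x. 2 * (cmod (F x))\<^sup>2 + 2 * (cmod (G x))\<^sup>2)"
    using assms[THEN L2_integrable_square] by auto
  then have "integrable (lebesgue_on J) (\<lambda>x. (cmod (F x + G x))\<^sup>2)"
    by (rule Bochner_Integration.integrable_bound) (auto simp: square_norm_add_le)
  then show ?thesis by (simp add: L2_def)
qed

lemma L2_cmult:
  assumes "F \<in> L2 J"
  shows "(\<lambda>x. c * F x) \<in> L2 J"
  using assms by (auto simp: L2_def norm_mult power_mult_distrib)

lemma L2_diff:
  assumes "F \<in> L2 J" "G \<in> L2 J"
  shows "(\<lambda>x. F x - G x) \<in> L2 J"
  using L2_add[OF assms(1) L2_cmult[OF assms(2), of "-1"]] by simp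

lemma L2_cnj: "F \<in> L2 J \<Longrightarrow> (\<lambda>x. cnj (F x)) \<in> L2 J"
  by (auto simp: L2_def intro!: measurable_compose[of F _ borel cnj]
      borel_measurable_continuous_onI continuous_intros)

lemma sqint_add_le:
  assumes "F \<in> L2 J" "G \<in> L2 J"
  shows "sqint J (\<lambda>x. F x + G x) \<le> 2 * sqint J F + 2 * sqint J G"
proof -
  have "sqint J (\<lambda>x. F x + G x) \<le> (LINT x|lebesgue_on J. 2 * (cmod (F x))\<^sup>2 + 2 * (cmod (G x))\<^sup>2)"
    unfolding sqint_def using L2_integrable_square[OF L2_add[OF assms]]
      assms[THEN L2_integrable_square]
    by (intro integral_mono) (auto simp: square_norm_add_le)
  then show ?thesis
    using assms[THEN L2_integrable_square] by (simp add: sqint_def)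
qed

lemma sqint_diff_triangle:
  assumes "F \<in> L2 J" "G \<in> L2 J" "H \<in> L2 J"
  shows "sqint J (\<lambda>x. F x - H x) \<le> 2 * sqint J (\<lambda>x. F x - G x) + 2 * sqint J (\<lambda>x. G x - H x)"
  using sqint_add_le[OF L2_diff[OF assms(1,2)] L2_diff[OF assms(2,3)]] by simp

text \<open>Both parts come from |F| |G| <= (|F|^2 + |G|^2) / 2, integrated.\<close>

lemma L2_mult_integrable:
  assumes "F \<in> L2 J" "G \<in> L2 J"
  shows "integrable (lebesgue_on J) (\<lambda>x. F x * G x)"
    and "cmod (LINT x|lebesgue_on J. F x * G x) \<le> (sqint J F + sqint J G) / 2"
proof -
  note [measurable] = assms[THEN L2_measurable]
  have i: "integrable (lebesgue_on J) (\<lambda>x. ((cmod (F x))\<^sup>2 + (cmod (G x))\<^sup>2) / 2)"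
    using assms[THEN L2_integrable_square] by auto
  have le: "cmod (F x * G x) \<le> ((cmod (F x))\<^sup>2 + (cmod (G x))\<^sup>2) / 2" for x
    using mult_le_half_squares[of "cmod (F x)" "cmod (G x)"] by (simp add: norm_mult)
  show int: "integrable (lebesgue_on J) (\<lambda>x. F x * G x)"
    by (rule Bochner_Integration.integrable_bound[OF i])
      (use le in \<open>auto intro: order_trans[OF le abs_ge_self]\<close>)
  have "cmod (LINT x|lebesgue_on J. F x * G x) \<le> (LINT x|lebesgue_on J. cmod (F x * G x))"
    by (rule integral_norm_bound)
  also have "\<dots> \<le> (LINT x|lebesgue_on J. ((cmod (F x))\<^sup>2 + (cmod (G x))\<^sup>2) / 2)"
    by (rule integral_mono) (use int i le in auto)
  also have "\<dots> = (sqint J F + sqint J G) / 2"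
    using assms[THEN L2_integrable_square] by (simp add: sqint_def)
  finally show "cmod (LINT x|lebesgue_on J. F x * G x) \<le> (sqint J F + sqint J G) / 2" .
qed

lemma sqint_tendsto_0:
  assumes "\<And>n. F n \<in> borel_measurable (lebesgue_on J)"
    and "integrable (lebesgue_on J) w"
    and "\<And>n x. x \<in> J \<Longrightarrow> (cmod (F n x))\<^sup>2 \<le> w x"
    and "AE x in lebesgue_on J. (\<lambda>n. F n x) \<longlonglongrightarrow> 0"
  shows "(\<lambda>n. sqint J (F n)) \<longlonglongrightarrow> 0"
proof -
  note [measurable] = assms(1)
  have "(\<lambda>n. LINT x|lebesgue_on J. (cmod (F n x))\<^sup>2) \<longlonglongrightarrow> (LINT x|lebesgue_on J. 0)"
  proof (rule integral_dominated_convergence[OF _ _ assms(2)])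
    show "AE x in lebesgue_on J. (\<lambda>n. (cmod (F n x))\<^sup>2) \<longlonglongrightarrow> 0"
      using assms(4)
    proof eventually_elim
      case (elim x)
      then show ?case using tendsto_power[OF tendsto_norm[OF elim], of 2] by simp
    qed
    show "AE x in lebesgue_on J. norm ((cmod (F n x))\<^sup>2) \<le> w x" for n
      using assms(3) by (intro AE_I2) auto
  qed auto
  then show ?thesis by (simp add: sqint_def)
qed

text \<open>The radial retraction of the plane onto the closed disc of radius m, for m > 0.\<close>

definition truncate :: "real \<Rightarrow> complex \<Rightarrow> complex" where
  "truncate m z = (m / max m (cmod z)) *\<^sub>R z"

lemma truncate_id: "0 < m \<Longrightarrow> cmod z \<le> m \<Longrightarrow> truncate m z = z"
  by (simp add: truncate_def max_def)

lemma norm_truncate_le: "0 < m \<Longrightarrow> cmod (truncate m z) \<le> m"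
  by (auto simp: truncate_def max_def field_simps)

lemma norm_diff_truncate_le: "0 < m \<Longrightarrow> cmod (z - truncate m z) \<le> cmod z"
proof -
  assume m: "0 < m"
  have "z - truncate m z = (1 - m / max m (cmod z)) *\<^sub>R z" by (simp add: truncate_def algebra_simps)
  moreover have "0 \<le> 1 - m / max m (cmod z)" "1 - m / max m (cmod z) \<le> 1"
    using m by (auto simp: field_simps)
  ultimately show ?thesis by (simp add: mult_left_le_one_le)
qed

lemma continuous_truncate: "0 < m \<Longrightarrow> continuous_on S (truncate m)"
  unfolding truncate_def by (intro continuous_intros) auto

context
  fixes a b :: real
  assumes ab: "a < b"
begin

interpretation L: finite_measure "lebesgue_on {a<..<b}"
  by (rule finite_measure_lebesgue_on) simp

lemma measure_interval: "measure (lebesgue_on {a<..<b}) {a<..<b} = b - a"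
  using ab by (simp add: measure_restrict_space)

lemma L2_bounded:
  assumes "F \<in> borel_measurable (lebesgue_on {a<..<b})" "\<And>x. x \<in> {a<..<b} \<Longrightarrow> cmod (F x) \<le> B"
  shows "F \<in> L2 {a<..<b}"
    and "sqint {a<..<b} F \<le> (b - a) * B\<^sup>2"
proof -
  note [measurable] = assms(1)
  have le: "(cmod (F x))\<^sup>2 \<le> B\<^sup>2" if "x \<in> {a<..<b}" for x
    using assms(2)[OF that] by (simp add: power_mono)
  have i: "integrable (lebesgue_on {a<..<b}) (\<lambda>x. (cmod (F x))\<^sup>2)"
    by (rule L.integrable_const_bound[of _ "B\<^sup>2"]) (use le in \<open>auto intro!: AE_I2\<close>)
  then show "F \<in> L2 {a<..<b}" using assms(1) by (simp add: L2_def)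
  have "sqint {a<..<b} F \<le> (LINT x|lebesgue_on {a<..<b}. B\<^sup>2)"
    unfolding sqint_def by (rule integral_mono) (use le i in auto)
  then show "sqint {a<..<b} F \<le> (b - a) * B\<^sup>2" by (simp add: measure_interval)
qed

lemma continuous_borel_measurable_interval:
  "continuous_on {a..b} F \<Longrightarrow> F \<in> borel_measurable (lebesgue_on {a<..<b})"
  by (rule continuous_imp_measurable_on_sets_lebesgue)
    (auto intro: continuous_on_subset)

lemma continuous_L2:
  fixes F :: "real \<Rightarrow> complex"
  assumes "continuous_on {a..b} F"
  shows "F \<in> L2 {a<..<b}"
proof -
  have "bounded (F ` {a..b})" using assms by (simp add: compact_continuous_image compact_imp_bounded)
  then obtain B where "\<And>x. x \<in> {a..b} \<Longrightarrow> cmod (F x) \<le> B" unfolding bounded_iff by (meson imageI)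
  then show ?thesis
    using continuous_borel_measurable_interval[OF assms] by (intro L2_bounded(1)[of _ B]) auto
qed

lemma test_function_L2: "\<phi> \<in> test_functions {a<..<b} \<Longrightarrow> \<phi> \<in> L2 {a<..<b}"
  by (intro continuous_L2 smooth_continuous) (simp add: test_functions_def)

lemma L2_integrable:
  assumes "F \<in> L2 {a<..<b}"
  shows "integrable (lebesgue_on {a<..<b}) F"
  using L2_mult_integrable(1)[OF assms continuous_L2[of "\<lambda>x. 1"]] by simp

text \<open>The variance of |F| about its mean m is nonnegative; expanding the square gives the
  inequality.\<close>

lemma L1_le_L2:
  assumes "F \<in> L2 {a<..<b}"
  shows "(LINT x|lebesgue_on {a<..<b}. cmod (F x))\<^sup>2 \<le> (b - a) * sqint {a<..<b} F"
proof -
  let ?L = "lebesgue_on {a<..<b}"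
  define I where "I = (LINT x|?L. cmod (F x))"
  define m where "m = I / (b - a)"
  have i: "integrable ?L (\<lambda>x. cmod (F x))" using L2_integrable[OF assms] by simp
  note j = L2_integrable_square[OF assms]
  have "0 \<le> (LINT x|?L. (cmod (F x) - m)\<^sup>2)" by simp
  also have "(\<lambda>x. (cmod (F x) - m)\<^sup>2) = (\<lambda>x. (cmod (F x))\<^sup>2 + (m\<^sup>2 - 2 * m * cmod (F x)))"
    by (simp add: power2_eq_square algebra_simps)
  also have "(LINT x|?L. (cmod (F x))\<^sup>2 + (m\<^sup>2 - 2 * m * cmod (F x)))
      = sqint {a<..<b} F + (m\<^sup>2 * (b - a) - 2 * m * I)"
    using i j by (simp add: sqint_def I_def measure_interval)
  also have I: "I = m * (b - a)" using ab by (simp add: m_def)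
  finally have "0 \<le> (b - a) * (sqint {a<..<b} F - m\<^sup>2 * (b - a))"
    using ab by (intro mult_nonneg_nonneg) (auto simp: power2_eq_square)
  then have "I\<^sup>2 \<le> (b - a) * sqint {a<..<b} F"
    by (simp add: I power2_eq_square algebra_simps)
  then show ?thesis by (simp add: I_def)
qed

text \<open>Four approximations in turn: truncate G to a bounded function, replace it by a truncated
  continuous function, replace that by a polynomial (Stone-Weierstrass), and multiply by a cutoff.
  All but the polynomial step are dominated convergence.\<close>

theorem test_functions_dense:
  assumes G: "G \<in> L2 {a<..<b}" and e: "0 < e"
  obtains \<psi> where "\<psi> \<in> test_functions {a<..<b}" "sqint {a<..<b} (\<lambda>x. G x - \<psi> x) < e"
proof -
  let ?J = "{a<..<b}"
  note [measurable] = L2_measurable[OF G]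
  have T_meas[measurable]: "truncate m \<in> borel_measurable borel" if "0 < m" for m
    by (rule borel_measurable_continuous_onI[OF continuous_truncate[OF that]])
  have "(\<lambda>n. sqint ?J (\<lambda>x. G x - truncate (Suc n) (G x))) \<longlonglongrightarrow> 0"
  proof (rule sqint_tendsto_0[OF _ L2_integrable_square[OF G]])
    show "(cmod (G x - truncate (real (Suc n)) (G x)))\<^sup>2 \<le> (cmod (G x))\<^sup>2" for n x
      by (intro power_mono norm_diff_truncate_le) auto
    have "(\<lambda>n. G x - truncate (real (Suc n)) (G x)) \<longlonglongrightarrow> 0" for x
    proof (rule tendsto_eventually)
      obtain N where "cmod (G x) \<le> real N" using real_arch_simple by blast
      then show "\<forall>\<^sub>F n in sequentially. G x - truncate (real (Suc n)) (G x) = 0"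
        by (intro eventually_sequentiallyI[of N]) (simp add: truncate_id)
    qed
    then show "AE x in lebesgue_on ?J. (\<lambda>n. G x - truncate (real (Suc n)) (G x)) \<longlonglongrightarrow> 0" by simp
  qed measurable
  \<comment> \<open>The tolerances e/8, e/16, e/64, e/64 fit three nested triangle inequalities,
    each doubling its terms: 2 (e/64 + e/64) = e/16, then 2 (e/16 + e/16) = e/4, then 2 (e/8 + e/4)
    < e.\<close>
  then have "\<forall>\<^sub>F n in sequentially. sqint ?J (\<lambda>x. G x - truncate (Suc n) (G x)) < e / 8"
    using e by (intro order_tendstoD(2)) auto
  then obtain n\<^sub>0 :: nat where n\<^sub>0: "sqint ?J (\<lambda>x. G x - truncate (Suc n\<^sub>0) (G x)) < e / 8"
    by (auto simp: eventually_sequentially)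
  define m where "m = real (Suc n\<^sub>0)"
  have m: "0 < m" and 1: "sqint ?J (\<lambda>x. G x - truncate m (G x)) < e / 8"
    using n\<^sub>0 by (simp_all only: m_def)
  have TG: "(\<lambda>x. truncate m (G x)) \<in> L2 ?J"
    using norm_truncate_le[OF m] T_meas[OF m] by (intro L2_bounded(1)[of _ m]) auto
  \<comment> \<open>A measurable function is an almost everywhere limit of continuous ones.
    Truncating these as well gives the constant majorant (2m)^2.\<close>
  obtain N h where N: "negligible N" and h: "\<And>n. continuous_on UNIV (h n)"
    and lim: "\<And>x. x \<notin> N \<Longrightarrow> (\<lambda>n::nat. h n x) \<longlonglongrightarrow> (if x \<in> ?J then G x else 0)"
    using L2_measurable[OF G] measurable_on_iff_borel_measurable[of ?J G] 
    unfolding measurable_on_def by auto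
  have contT: "continuous_on S (\<lambda>x. truncate m (h n x))" for n S
    by (intro continuous_on_compose2[OF continuous_truncate[OF m, of UNIV] continuous_on_subset[OF h]]) auto
  have "(\<lambda>n. sqint ?J (\<lambda>x. truncate m (G x) - truncate m (h n x))) \<longlonglongrightarrow> 0"
  proof (rule sqint_tendsto_0)
    show "(\<lambda>x. truncate m (G x) - truncate m (h n x)) \<in> borel_measurable (lebesgue_on ?J)" for n
      using L2_measurable[OF TG] continuous_borel_measurable_interval[OF contT] by auto
    show "integrable (lebesgue_on ?J) (\<lambda>x. (2 * m)\<^sup>2)" by simp
    show "(cmod (truncate m (G x) - truncate m (h n x)))\<^sup>2 \<le> (2 * m)\<^sup>2" for n x
      using norm_triangle_ineq4[of "truncate m (G x)" "truncate m (h n x)"]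
        norm_truncate_le[OF m, of "G x"] norm_truncate_le[OF m, of "h n x"]
      by (intro power_mono) auto
    have "AE x in lebesgue. x \<notin> N"
      using N by (simp add: AE_not_in negligible_iff_null_sets)
    then have "AE x in lebesgue_on ?J. x \<in> ?J \<and> x \<notin> N"
      by (auto simp: AE_restrict_space_iff elim: eventually_mono)
    then show "AE x in lebesgue_on ?J. (\<lambda>n. truncate m (G x) - truncate m (h n x)) \<longlonglongrightarrow> 0"
    proof eventually_elim
      case (elim x)
      then have "(\<lambda>n. truncate m (h n x)) \<longlonglongrightarrow> truncate m (G x)"
        using lim[of x] continuous_on_tendsto_compose[OF continuous_truncate[OF m, of UNIV]] by simp
      from tendsto_diff[OF tendsto_const[of "truncate m (G x)"] this] show ?case by simp
    qed
  qed
  then have "\<forall>\<^sub>F n in sequentially. sqint ?J (\<lambda>x. truncate m (G x) - truncate m (h n x)) < e / 16"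
    using e by (intro order_tendstoD(2)) auto
  then obtain n where 2: "sqint ?J (\<lambda>x. truncate m (G x) - truncate m (h n x)) < e / 16"
    by (auto simp: eventually_sequentially)
  \<comment> \<open>Chosen so that a uniform error d costs (b - a) d^2 = e/64.\<close>
  define d where "d = sqrt (e / 64 / (b - a))"
  have "0 < d" and d: "d\<^sup>2 = e / 64 / (b - a)" using e ab by (simp_all add: d_def)
  then obtain p where p: "polynomial_function p" "\<And>x. x \<in> {a..b} \<Longrightarrow> cmod (truncate m (h n x) - p x) < d"
    using Stone_Weierstrass_polynomial_function[OF compact_Icc contT \<open>0 < d\<close>, of a b n] by blast
  have sp: "smooth p" by (rule smooth_polynomial_function[OF p(1)])
  note pc = smooth_continuous[OF sp]
  have "sqint ?J (\<lambda>x. truncate m (h n x) - p x) \<le> (b - a) * d\<^sup>2"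
    using p(2) by (intro L2_bounded(2) borel_measurable_diff continuous_borel_measurable_interval contT pc)
      (auto intro: less_imp_le)
  also have "\<dots> = e / 64"
    unfolding d times_divide_eq_right[of "b - a" "e / 64"]
    by (rule nonzero_mult_div_cancel_left) (use ab in simp)
  finally have 3: "sqint ?J (\<lambda>x. truncate m (h n x) - p x) \<le> e / 64" .
  let ?c = "\<lambda>n x. complex_of_real (cutoff a b n x)"
  have pt: "(\<lambda>x. p x * ?c n x) \<in> test_functions ?J" for n
    by (rule test_function_smooth_mult[OF cutoff_test_function[OF ab] sp ab])
  have "(\<lambda>n. sqint ?J (\<lambda>x. p x - p x * ?c n x)) \<longlonglongrightarrow> 0"
  proof (rule sqint_tendsto_0[OF _ L2_integrable_square[OF continuous_L2[OF pc]]])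
    show "(\<lambda>x. p x - p x * ?c n x) \<in> borel_measurable (lebesgue_on ?J)" for n
      using L2_diff[OF continuous_L2[OF pc] test_function_L2[OF pt]] by (rule L2_measurable)
    show "(cmod (p x - p x * ?c n x))\<^sup>2 \<le> (cmod (p x))\<^sup>2" for n x
    proof -
      have "p x - p x * ?c n x = p x * of_real (1 - cutoff a b n x)" by (simp add: algebra_simps)
      then have "cmod (p x - p x * ?c n x) = cmod (p x) * (1 - cutoff a b n x)"
        using cutoff_le_1[of a b n x] by (simp only: norm_mult norm_of_real)
      then show ?thesis using cutoff_nonneg[of a b n x] cutoff_le_1[of a b n x]
        by (intro power_mono) (auto simp: mult_left_le)
    qed
    have "(\<lambda>n. p x - p x * ?c n x) \<longlonglongrightarrow> 0" if "x \<in> ?J" for x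
      using tendsto_diff[OF tendsto_const[of "p x"] tendsto_mult[OF tendsto_const[of "p x"] tendsto_of_real[OF cutoff_tendsto_1[OF that]]]]
      by simp
    then show "AE x in lebesgue_on ?J. (\<lambda>n. p x - p x * ?c n x) \<longlonglongrightarrow> 0" by (intro AE_I2) simp
  qed
  then have "\<forall>\<^sub>F n in sequentially. sqint ?J (\<lambda>x. p x - p x * ?c n x) < e / 64"
    using e by (intro order_tendstoD(2)) auto
  then obtain k where 4: "sqint ?J (\<lambda>x. p x - p x * ?c k x) < e / 64"
    by (auto simp: eventually_sequentially)
  let ?\<psi> = "\<lambda>x. p x * ?c k x"
  note l2 = G TG continuous_L2[OF contT] continuous_L2[OF pc] test_function_L2[OF pt]
  have "sqint ?J (\<lambda>x. truncate m (h n x) - ?\<psi> x) < e / 16"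
    using sqint_diff_triangle[OF l2(3,4,5), of n k] 3 4 by simp
  then have "sqint ?J (\<lambda>x. truncate m (G x) - ?\<psi> x) < e / 4"
    using sqint_diff_triangle[OF l2(2,3,5), of k n] 2 by simp
  then have "sqint ?J (\<lambda>x. G x - ?\<psi> x) < e"
    using sqint_diff_triangle[OF l2(1,2,5), of k] 1 e by simp
  then show ?thesis using that[OF pt] by blast
qed

text \<open>If a test function \<psi> is within e of the conjugate of h in \<open>sqint\<close>,
  then the squared norm of h is the integral of h (cnj h - \<psi>). This is at most half that
  squared norm plus e/2, so the squared norm is at most e.\<close>

theorem fundamental_lemma_variations:
  assumes h: "h \<in> L2 {a<..<b}"
    and zero: "\<And>\<phi>. \<phi> \<in> test_functions {a<..<b} \<Longrightarrow> (LINT x|lebesgue_on {a<..<b}. h x * \<phi> x) = 0"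
  shows "AE x in lebesgue_on {a<..<b}. h x = 0"
proof -
  let ?J = "{a<..<b}"
  have sq: "h x * cnj (h x) = of_real ((cmod (h x))\<^sup>2)" for x
    using complex_norm_square[of "h x"] by simp
  have "sqint ?J h \<le> e" if e: "e > 0" for e
  proof -
    obtain \<psi> where \<psi>: "\<psi> \<in> test_functions ?J" "sqint ?J (\<lambda>x. cnj (h x) - \<psi> x) < e"
      using test_functions_dense[OF L2_cnj[OF h] e] by blast
    have "of_real (sqint ?J h) = (LINT x|lebesgue_on ?J. h x * cnj (h x))"
      unfolding sq sqint_def by (rule integral_complex_of_real[symmetric])
    also have "\<dots> = (LINT x|lebesgue_on ?J. h x * (cnj (h x) - \<psi> x))"
      using zero[OF \<psi>(1)] L2_mult_integrable(1)[OF h L2_cnj[OF h]]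
        L2_mult_integrable(1)[OF h test_function_L2[OF \<psi>(1)]]
      by (simp add: right_diff_distrib)
    finally have "cmod (of_real (sqint ?J h)) \<le> (sqint ?J h + sqint ?J (\<lambda>x. cnj (h x) - \<psi> x)) / 2"
      using L2_mult_integrable(2)[OF h L2_diff[OF L2_cnj[OF h] test_function_L2[OF \<psi>(1)]]] by simp
    then show ?thesis using \<psi>(2) sqint_nonneg[of ?J h] by simp
  qed
  then have "sqint ?J h \<le> 0" by (rule field_le_epsilon[where y = 0, simplified])
  then have "sqint ?J h = 0" using sqint_nonneg[of ?J h] by simp
  then have "AE x in lebesgue_on ?J. (cmod (h x))\<^sup>2 = 0"
    unfolding sqint_def using L2_integrable_square[OF h] integral_nonneg_eq_0_iff_AE[of "lebesgue_on ?J" "\<lambda>x. (cmod (h x))\<^sup>2"]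
    by simp
  then show ?thesis by simp
qed

theorem weak_deriv_unique_AE:
  assumes "g \<in> L2 {a<..<b}" "h \<in> L2 {a<..<b}"
    "has_weak_deriv {a<..<b} y g" "has_weak_deriv {a<..<b} y h"
  shows "AE x in lebesgue_on {a<..<b}. g x = h x"
proof -
  have "AE x in lebesgue_on {a<..<b}. g x - h x = 0"
  proof (rule fundamental_lemma_variations[OF L2_diff[OF assms(1,2)]])
    fix \<phi> assume \<phi>: "\<phi> \<in> test_functions {a<..<b}"
    show "(LINT x|lebesgue_on {a<..<b}. (g x - h x) * \<phi> x) = 0"
      using L2_mult_integrable(1)[OF assms(1) test_function_L2[OF \<phi>]]
        L2_mult_integrable(1)[OF assms(2) test_function_L2[OF \<phi>]] assms(3,4) \<phi>
      by (simp add: left_diff_distrib has_weak_deriv_def)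
  qed
  then show ?thesis by simp
qed

end

section \<open>Primitives\<close>

text \<open>The only form of integration by parts in the proof. It is stated for two arbitrary
  finite measures so that Lebesgue measure can be paired with itself or with a part of \<mu>.
  Measurability of the identity makes the triangle t < s measurable in the product.\<close>

lemma Fubini_triangle:
  fixes h g :: "real \<Rightarrow> complex"
  assumes "finite_measure P" "finite_measure Q"
    and idP: "(\<lambda>x. x) \<in> borel_measurable P" and idQ: "(\<lambda>x. x) \<in> borel_measurable Q"
    and h: "integrable P h" and g: "integrable Q g"
  shows "(LINT s|P. h s * (LINT t|Q. of_bool (t < s) * g t)) =
         (LINT t|Q. g t * (LINT s|P. of_bool (t < s) * h s))" (is ?eq)
    and "integrable P (\<lambda>s. h s * (LINT t|Q. of_bool (t < s) * g t))" (is ?i1)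
    and "integrable Q (\<lambda>t. g t * (LINT s|P. of_bool (t < s) * h s))" (is ?i2)
proof -
  interpret P: finite_measure P by fact
  interpret Q: finite_measure Q by fact
  interpret PQ: pair_sigma_finite P Q by standard
  note [measurable] = borel_measurable_integrable[OF h] borel_measurable_integrable[OF g] idP idQ
  let ?f = "\<lambda>s t. h s * (of_bool (t < s) * g t)"
  have meas: "case_prod ?f \<in> borel_measurable (P \<Otimes>\<^sub>M Q)"
    by measurable
  have meas2: "(\<lambda>(s, t). norm (h s) * norm (g t)) \<in> borel_measurable (P \<Otimes>\<^sub>M Q)" by measurable
  have "integrable (P \<Otimes>\<^sub>M Q) (\<lambda>(s, t). norm (h s) * norm (g t))"
    using h g by (intro PQ.Fubini_integrable meas2) auto
  then have int: "integrable (P \<Otimes>\<^sub>M Q) (case_prod ?f)"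
    by (rule Bochner_Integration.integrable_bound[OF _ meas]) (auto simp: norm_mult)
  have 1: "(LINT t|Q. ?f s t) = h s * (LINT t|Q. of_bool (t < s) * g t)" for s by simp
  have 2: "(LINT s|P. ?f s t) = g t * (LINT s|P. of_bool (t < s) * h s)" for t
  proof -
    have "(LINT s|P. ?f s t) = (LINT s|P. g t * (of_bool (t < s) * h s))"
      by (rule Bochner_Integration.integral_cong) auto
    then show ?thesis by simp
  qed
  show ?eq using PQ.Fubini_integral[OF int] unfolding 1 2 by simp
  show ?i1 using PQ.integrable_fst[OF int] unfolding 1 .
  show ?i2 using PQ.integrable_snd[OF int] unfolding 2 .
qed

text \<open>The primitive vanishing at the left end. The indicator form matches
  \<open>Fubini_triangle\<close> and defines the primitive on the whole line, constant on either
  side of the interval.\<close>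

definition prim :: "real set \<Rightarrow> (real \<Rightarrow> complex) \<Rightarrow> real \<Rightarrow> complex" where
  "prim J G x = (LINT t|lebesgue_on J. of_bool (t < x) * G t)"

lemma id_measurable_lebesgue_on: "(\<lambda>x::real. x) \<in> borel_measurable (lebesgue_on J)"
  by (intro measurable_restrict_space1 measurable_completion) simp

lemma integrable_of_bool_mult:
  fixes G :: "real \<Rightarrow> complex"
  assumes "integrable M G" and [measurable]: "(\<lambda>x. x) \<in> borel_measurable M"
  shows "integrable M (\<lambda>t. of_bool (t < x) * G t)"
    and "integrable M (\<lambda>t. of_bool (x < t) * G t)"
proof -
  note [measurable] = borel_measurable_integrable[OF assms(1)]
  show "integrable M (\<lambda>t. of_bool (t < x) * G t)" "integrable M (\<lambda>t. of_bool (x < t) * G t)"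
    by (rule Bochner_Integration.integrable_bound[OF assms(1)]; auto)+
qed

lemma AE_lebesgue_on_neq: "AE t in lebesgue_on J. t \<noteq> (x::real)" if "J \<in> sets lebesgue"
proof -
  have "AE t in lebesgue. t \<noteq> x"
    using AE_not_in[of "{x}" lebesgue] negligible_sing[of x] negligible_iff_null_sets by fastforce
  then show ?thesis using that by (auto simp: AE_restrict_space_iff elim: eventually_mono)
qed

context
  fixes a b :: real
  assumes ab: "a < b"
begin

interpretation L: finite_measure "lebesgue_on {a<..<b}"
  by (rule finite_measure_lebesgue_on) simp

lemma prim_integrable:
  fixes G :: "real \<Rightarrow> complex"
  shows "integrable (lebesgue_on {a<..<b}) G \<Longrightarrow> integrable (lebesgue_on {a<..<b}) (\<lambda>t. of_bool (t < x) * G t)"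
  by (rule integrable_of_bool_mult(1)[OF _ id_measurable_lebesgue_on])

lemma norm_prim_le:
  assumes "integrable (lebesgue_on {a<..<b}) G"
  shows "cmod (prim {a<..<b} G x) \<le> (LINT t|lebesgue_on {a<..<b}. cmod (G t))"
proof -
  have "cmod (prim {a<..<b} G x) \<le> (LINT t|lebesgue_on {a<..<b}. cmod (of_bool (t < x) * G t))"
    unfolding prim_def by (rule integral_norm_bound)
  also have "\<dots> \<le> (LINT t|lebesgue_on {a<..<b}. cmod (G t))"
    by (rule integral_mono[OF integrable_norm[OF prim_integrable[OF assms]] integrable_norm[OF assms]])
      (auto simp: norm_mult)
  finally show ?thesis .
qed

lemma prim_add:
  assumes "integrable (lebesgue_on {a<..<b}) G" "integrable (lebesgue_on {a<..<b}) H"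
  shows "prim {a<..<b} (\<lambda>t. G t + H t) x = prim {a<..<b} G x + prim {a<..<b} H x"
  using assms[THEN prim_integrable] by (simp add: prim_def distrib_left)

lemma prim_cmult: "prim {a<..<b} (\<lambda>t. c * G t) x = c * prim {a<..<b} G x"
proof -
  have "prim {a<..<b} (\<lambda>t. c * G t) x = (LINT t|lebesgue_on {a<..<b}. c * (of_bool (t < x) * G t))"
    unfolding prim_def by (rule Bochner_Integration.integral_cong) auto
  then show ?thesis by (simp add: prim_def)
qed

lemma prim_diff:
  assumes "integrable (lebesgue_on {a<..<b}) G" "integrable (lebesgue_on {a<..<b}) H"
  shows "prim {a<..<b} (\<lambda>t. G t - H t) x = prim {a<..<b} G x - prim {a<..<b} H x"
  using prim_add[OF assms(1), of "\<lambda>t. (-1) * H t" x] prim_cmult[of "-1" H x] assms(2) by simp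

lemma prim_left: "x \<le> a \<Longrightarrow> prim {a<..<b} G x = 0"
proof -
  assume "x \<le> a"
  then have "prim {a<..<b} G x = (LINT t|lebesgue_on {a<..<b}. 0)"
    unfolding prim_def by (intro Bochner_Integration.integral_cong) auto
  then show ?thesis by simp
qed

lemma prim_right: "b \<le> x \<Longrightarrow> prim {a<..<b} G x = integral\<^sup>L (lebesgue_on {a<..<b}) G"
  unfolding prim_def by (intro Bochner_Integration.integral_cong) auto

lemma integral_upper:
  assumes "integrable (lebesgue_on {a<..<b}) G"
  shows "(LINT t|lebesgue_on {a<..<b}. of_bool (x < t) * G t)
    = integral\<^sup>L (lebesgue_on {a<..<b}) G - prim {a<..<b} G x"
proof -
  note i = integrable_of_bool_mult[OF assms id_measurable_lebesgue_on]
  note [measurable] = borel_measurable_integrable[OF assms] id_measurable_lebesgue_on[of "{a<..<b}"]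
  have "integral\<^sup>L (lebesgue_on {a<..<b}) G =
    (LINT t|lebesgue_on {a<..<b}. of_bool (t < x) * G t + of_bool (x < t) * G t)"
    by (rule integral_cong_AE) (use AE_lebesgue_on_neq[of "{a<..<b}" x] in \<open>auto elim!: eventually_mono\<close>)
  then show ?thesis using i by (simp add: prim_def)
qed

lemma continuous_prim:
  assumes G: "integrable (lebesgue_on {a<..<b}) G"
  shows "continuous_on S (prim {a<..<b} G)"
proof (intro continuous_at_imp_continuous_on ballI)
  fix x
  note [measurable] = borel_measurable_integrable[OF G] id_measurable_lebesgue_on[of "{a<..<b}"]
  show "isCont (prim {a<..<b} G) x"
    unfolding continuous_at_sequentially comp_def prim_def
  proof (intro allI impI, rule integral_dominated_convergence)
    fix u :: "nat \<Rightarrow> real" assume u: "u \<longlonglongrightarrow> x"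
    show "integrable (lebesgue_on {a<..<b}) (\<lambda>t. cmod (G t))" using G by simp
    show "AE t in lebesgue_on {a<..<b}. (\<lambda>n. of_bool (t < u n) * G t) \<longlonglongrightarrow> of_bool (t < x) * G t"
      using AE_lebesgue_on_neq[of "{a<..<b}" x, simplified]
    proof eventually_elim
      case (elim t)
      then have "\<forall>\<^sub>F n in sequentially. (t < u n) = (t < x)"
        using order_tendstoD[OF u, of t] by (cases "t < x") (auto elim: eventually_mono)
      then show ?case by (intro tendsto_eventually) (auto elim: eventually_mono)
    qed
  qed (auto simp: norm_mult)
qed

lemma prim_eq_integral:
  assumes "integrable (lebesgue_on {a<..<b}) G" "x \<in> {a..b}"
  shows "prim {a<..<b} G x = integral {a..x} G"
proof -
  have "prim {a<..<b} G x = integral {a<..<b} (\<lambda>t. of_bool (t < x) * G t)"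
    unfolding prim_def using prim_integrable[OF assms(1)] by (intro lebesgue_integral_eq_integral) auto
  also have "\<dots> = integral {a<..<b} (\<lambda>t. if t \<in> {a<..<x} then G t else 0)"
    by (rule integral_cong) auto
  also have "\<dots> = integral ({a<..<b} \<inter> {a<..<x}) G"
    using integral_restrict_Int[of "{a<..<b}" "{a<..<x}" G] by (simp add: Int_commute)
  also have "{a<..<b} \<inter> {a<..<x} = {a<..<x}" using assms(2) by auto
  also have "integral {a<..<x} G = integral {a..x} G"
    by (simp add: integral_open_interval_real)
  finally show ?thesis .
qed

lemma prim_has_vector_derivative:
  assumes G: "continuous_on {a..b} G" and x: "x \<in> {a<..<b}"
  shows "(prim {a<..<b} G has_vector_derivative G x) (at x)"
proof -
  note i = L2_integrable[OF ab continuous_L2[OF ab G]]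
  have "((\<lambda>u. integral {a..u} G) has_vector_derivative G x) (at x within {a..b})"
    using integral_has_vector_derivative[OF G] x by auto
  then have "((\<lambda>u. integral {a..u} G) has_vector_derivative G x) (at x)"
    using x by (simp add: at_within_Icc_at)
  then show ?thesis
    by (rule has_vector_derivative_transform_within_open[of _ _ _ "{a<..<b}"])
       (use x prim_eq_integral[OF i] in auto)
qed

lemma prim_vector_derivative_test_function:
  assumes \<phi>: "\<phi> \<in> test_functions {a<..<b}"
  shows "prim {a<..<b} (\<lambda>x. vector_derivative \<phi> (at x)) = \<phi>"
    and "(LINT x|lebesgue_on {a<..<b}. vector_derivative \<phi> (at x)) = 0"
proof -
  let ?d = "\<lambda>x. vector_derivative \<phi> (at x)"
  have s: "smooth \<phi>" using \<phi> by (simp add: test_functions_def)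
  note i = L2_integrable[OF ab test_function_L2[OF ab test_function_deriv[OF \<phi> ab]]]
  have eq: "prim {a<..<b} ?d x = \<phi> x" if "x \<in> {a..b}" for x
  proof -
    have "(?d has_integral (\<phi> x - \<phi> a)) {a..x}"
      using that by (intro fundamental_theorem_of_calculus)
        (auto intro: has_vector_derivative_at_within smoothE(1)[OF s])
    then show ?thesis
      using prim_eq_integral[OF i that] test_function_outside[OF \<phi> ab, of a] by (simp add: integral_unique)
  qed
  show int: "integral\<^sup>L (lebesgue_on {a<..<b}) ?d = 0"
    using eq[of b] prim_right[of b ?d] test_function_outside[OF \<phi> ab, of b] ab by simp
  show "prim {a<..<b} ?d = \<phi>"
  proof
    fix x
    show "prim {a<..<b} ?d x = \<phi> x"
      using eq[of x] prim_left[of x ?d] prim_right[of x ?d] int test_function_outside[OF \<phi> ab, of x]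
      by (cases "x \<le> a"; cases "b \<le> x") auto
  qed
qed

text \<open>Left of the support of \<psi> the primitive is 0, right of it it is the full integral of
  \<psi>. The zero mean therefore gives compact support.\<close>

lemma prim_test_function:
  assumes \<psi>: "\<psi> \<in> test_functions {a<..<b}" and 0: "integral\<^sup>L (lebesgue_on {a<..<b}) \<psi> = 0"
  shows "prim {a<..<b} \<psi> \<in> test_functions {a<..<b}"
    and "vector_derivative (prim {a<..<b} \<psi>) (at x) = \<psi> x"
proof -
  obtain c d where cd: "smooth \<psi>" "a < c" "c \<le> d" "d < b" "\<And>x. \<psi> x \<noteq> 0 \<Longrightarrow> c \<le> x \<and> x \<le> d"
    using test_functionE[OF \<psi> ab] by blast
  have L: "prim {a<..<b} \<psi> x = 0" if "x < c" for x
  proof -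
    have "prim {a<..<b} \<psi> x = (LINT t|lebesgue_on {a<..<b}. 0)"
      unfolding prim_def using that cd(5) by (intro Bochner_Integration.integral_cong) force+
    then show ?thesis by simp
  qed
  have R: "prim {a<..<b} \<psi> x = 0" if "x > d" for x
  proof -
    have "prim {a<..<b} \<psi> x = integral\<^sup>L (lebesgue_on {a<..<b}) \<psi>"
      unfolding prim_def using that cd(5) by (intro Bochner_Integration.integral_cong) force+
    then show ?thesis using 0 by simp
  qed
  have d: "(prim {a<..<b} \<psi> has_vector_derivative \<psi> x) (at x)" for x
  proof (cases "x \<in> {c..d}")
    case True
    then show ?thesis
      using cd by (intro prim_has_vector_derivative smooth_continuous) auto
  next
    case False
    then have "\<psi> x = 0" using cd(5)[of x] by auto
    then have "((\<lambda>x. 0) has_vector_derivative \<psi> x) (at x)" by simp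
    then show ?thesis
      by (rule has_vector_derivative_transform_within_open[of _ _ _ "- {c..d}"])
         (use False L R in force)+
  qed
  have s: "smooth (prim {a<..<b} \<psi>)" by (rule smooth_integrate[OF d cd(1)])
  show "prim {a<..<b} \<psi> \<in> test_functions {a<..<b}"
    by (rule test_functionI[OF s cd(2,4)]) (use L R in force)
  show "vector_derivative (prim {a<..<b} \<psi>) (at x) = \<psi> x"
    by (rule vector_derivative_at[OF d])
qed

text \<open>Exchanging integrals pairs G(t) with the integral of \<phi>' beyond t. As \<phi>' has
  total integral 0 and primitive \<phi>, this is -\<phi>(t).\<close>

lemma has_weak_deriv_prim:
  assumes G: "integrable (lebesgue_on {a<..<b}) G"
    and y: "\<And>x. x \<in> {a<..<b} \<Longrightarrow> y x = y\<^sub>0 + prim {a<..<b} G x"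
  shows "has_weak_deriv {a<..<b} y G"
  unfolding has_weak_deriv_def
proof
  fix \<phi> assume \<phi>: "\<phi> \<in> test_functions {a<..<b}"
  let ?L = "lebesgue_on {a<..<b}" and ?d = "\<lambda>x. vector_derivative \<phi> (at x)"
  note i = L2_integrable[OF ab test_function_L2[OF ab test_function_deriv[OF \<phi> ab]]]
  note F = Fubini_triangle[OF L.finite_measure_axioms L.finite_measure_axioms
      id_measurable_lebesgue_on id_measurable_lebesgue_on i G, folded prim_def]
  have "(LINT x|?L. y x * ?d x) = (LINT x|?L. y\<^sub>0 * ?d x + ?d x * prim {a<..<b} G x)"
    using y by (intro Bochner_Integration.integral_cong) (auto simp: algebra_simps)
  also have "\<dots> = (LINT x|?L. ?d x * prim {a<..<b} G x)"
    using i F(2) prim_vector_derivative_test_function(2)[OF \<phi>] by simp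
  also have "\<dots> = (LINT t|?L. G t * - \<phi> t)"
    unfolding F(1) integral_upper[OF i] prim_vector_derivative_test_function[OF \<phi>] by simp
  finally show "(LINT x|?L. y x * ?d x) = - (LINT x|?L. G x * \<phi> x)" by simp
qed

text \<open>The integrated product rule: the product is an integral over a square with side from a
  to x, and the diagonal splits the square into two triangles.\<close>

lemma prim_mult:
  assumes g: "integrable (lebesgue_on {a<..<b}) g" and h: "integrable (lebesgue_on {a<..<b}) h"
  shows "prim {a<..<b} g x * prim {a<..<b} h x =
    prim {a<..<b} (\<lambda>t. g t * prim {a<..<b} h t + prim {a<..<b} g t * h t) x"
proof -
  let ?L = "lebesgue_on {a<..<b}"
  let ?g = "\<lambda>t. of_bool (t < x) * g t" and ?h = "\<lambda>t. of_bool (t < x) * h t"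
  note i = prim_integrable[OF g, of x] prim_integrable[OF h, of x]
  note F = Fubini_triangle[OF L.finite_measure_axioms L.finite_measure_axioms
      id_measurable_lebesgue_on id_measurable_lebesgue_on i, folded prim_def]
  note F' = Fubini_triangle[OF L.finite_measure_axioms L.finite_measure_axioms
      id_measurable_lebesgue_on id_measurable_lebesgue_on i(2,1), folded prim_def]
  \<comment> \<open>For s < x, cutting the integrand off at x does not change the primitive at
    s.\<close>
  have cut: "of_bool (s < x) * prim {a<..<b} (\<lambda>t. of_bool (t < x) * f t) s
      = of_bool (s < x) * prim {a<..<b} f s" for s and f :: "real \<Rightarrow> complex"
  proof (cases "s < x")
    case True
    have "prim {a<..<b} (\<lambda>t. of_bool (t < x) * f t) s = prim {a<..<b} f s"
      unfolding prim_def using True by (intro Bochner_Integration.integral_cong) auto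
    then show ?thesis by simp
  qed simp
  have "(LINT s|?L. ?g s * prim {a<..<b} ?h s) =
      (LINT t|?L. prim {a<..<b} g x * ?h t - ?h t * prim {a<..<b} ?g t)"
    unfolding F(1) integral_upper[OF i(1)] by (simp add: prim_def algebra_simps)
  also have "\<dots> = prim {a<..<b} g x * prim {a<..<b} h x - (LINT t|?L. ?h t * prim {a<..<b} ?g t)"
    using i(2) F'(2) by (simp add: prim_def)
  finally have "prim {a<..<b} g x * prim {a<..<b} h x =
      (LINT t|?L. ?g t * prim {a<..<b} ?h t + ?h t * prim {a<..<b} ?g t)"
    using F(2) F'(2) by simp
  also have "\<dots> = prim {a<..<b} (\<lambda>t. g t * prim {a<..<b} h t + prim {a<..<b} g t * h t) x"
    unfolding prim_def[of _ "\<lambda>t. g t * prim {a<..<b} h t + prim {a<..<b} g t * h t"]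
    using cut[of _ g] cut[of _ h]
    by (intro Bochner_Integration.integral_cong) (auto simp: algebra_simps)
  finally show ?thesis .
qed

end

section \<open>The space \<open>W\<^sub>0\<^sup>1\<^sup>,\<^sup>2\<close>\<close>

lemma weak_deriv_works:
  assumes "y \<in> W12 J"
  shows "weak_deriv J y \<in> L2 J" "has_weak_deriv J y (weak_deriv J y)"
proof -
  have "\<exists>g. g \<in> L2 J \<and> has_weak_deriv J y g" using assms by (auto simp: W12_def)
  from someI_ex[OF this] show "weak_deriv J y \<in> L2 J" "has_weak_deriv J y (weak_deriv J y)"
    unfolding weak_deriv_def by blast+
qed

lemma W12_norm_eq: "W12_norm J y = sqrt (sqint J y + sqint J (weak_deriv J y))"
  by (simp add: W12_norm_def sqint_def)

lemma sqint_le_W12_norm: "sqint J y \<le> (W12_norm J y)\<^sup>2" "sqint J (weak_deriv J y) \<le> (W12_norm J y)\<^sup>2"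
  using sqint_nonneg[of J y] sqint_nonneg[of J "weak_deriv J y"] by (simp_all add: W12_norm_eq)

lemma sqint_cong_AE:
  assumes "AE x in lebesgue_on J. F x = G x" "F \<in> L2 J" "G \<in> L2 J"
  shows "sqint J F = sqint J G"
  unfolding sqint_def
proof (rule integral_cong_AE)
  note [measurable] = assms(2,3)[THEN L2_measurable]
  show "(\<lambda>x. (cmod (F x))\<^sup>2) \<in> borel_measurable (lebesgue_on J)"
    "(\<lambda>x. (cmod (G x))\<^sup>2) \<in> borel_measurable (lebesgue_on J)" by measurable
qed (use assms(1) in auto)

lemma sqint_cong: "(\<And>x. x \<in> J \<Longrightarrow> F x = G x) \<Longrightarrow> sqint J F = sqint J G"
  unfolding sqint_def by (intro Bochner_Integration.integral_cong) auto

context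
  fixes a b :: real
  assumes ab: "a < b"
begin

interpretation L: finite_measure "lebesgue_on {a<..<b}"
  by (rule finite_measure_lebesgue_on) simp

lemma closure_interval: "closure {a<..<b} = {a..b}"
  using ab by simp

lemma weak_deriv_AE_eq:
  assumes "g \<in> L2 {a<..<b}" "has_weak_deriv {a<..<b} y g"
  shows "AE x in lebesgue_on {a<..<b}. weak_deriv {a<..<b} y x = g x"
    and "weak_deriv {a<..<b} y \<in> L2 {a<..<b}"
proof -
  have "\<exists>g. g \<in> L2 {a<..<b} \<and> has_weak_deriv {a<..<b} y g" using assms by auto
  from someI_ex[OF this]
  have *: "weak_deriv {a<..<b} y \<in> L2 {a<..<b}" "has_weak_deriv {a<..<b} y (weak_deriv {a<..<b} y)"
    unfolding weak_deriv_def by blast+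
  show "AE x in lebesgue_on {a<..<b}. weak_deriv {a<..<b} y x = g x"
    by (rule weak_deriv_unique_AE[OF ab *(1) assms(1) *(2) assms(2)])
  show "weak_deriv {a<..<b} y \<in> L2 {a<..<b}" by fact
qed

lemma W12_primI:
  assumes "g \<in> L2 {a<..<b}" and "\<And>x. x \<in> {a..b} \<Longrightarrow> y x = y\<^sub>0 + prim {a<..<b} g x"
  shows "y \<in> W12 {a<..<b}" "has_weak_deriv {a<..<b} y g"
proof -
  note i = L2_integrable[OF ab assms(1)]
  have "continuous_on {a..b} (\<lambda>x. y\<^sub>0 + prim {a<..<b} g x)"
    by (intro continuous_intros continuous_prim[OF ab i])
  then have c: "continuous_on {a..b} y"
    by (rule continuous_on_eq) (use assms(2) in auto)
  show w: "has_weak_deriv {a<..<b} y g"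
    by (rule has_weak_deriv_prim[OF ab i, of _ y\<^sub>0]) (use assms(2) in auto)
  show "y \<in> W12 {a<..<b}"
    using c w assms(1) continuous_L2[OF ab c] by (auto simp: W12_def closure_interval)
qed

lemma norm_prim_L2:
  assumes "G \<in> L2 {a<..<b}"
  shows "(cmod (prim {a<..<b} G x))\<^sup>2 \<le> (b - a) * sqint {a<..<b} G"
proof -
  have "(cmod (prim {a<..<b} G x))\<^sup>2 \<le> (LINT t|lebesgue_on {a<..<b}. cmod (G t))\<^sup>2"
    using norm_prim_le[OF ab L2_integrable[OF ab assms]] by (intro power_mono) auto
  also have "\<dots> \<le> (b - a) * sqint {a<..<b} G" by (rule L1_le_L2[OF ab assms])
  finally show ?thesis .
qed

lemma norm_integral_L2:
  assumes "G \<in> L2 {a<..<b}"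
  shows "(cmod (integral\<^sup>L (lebesgue_on {a<..<b}) G))\<^sup>2 \<le> (b - a) * sqint {a<..<b} G"
  using norm_prim_L2[OF assms, of b] prim_right[OF ab, of b G] by simp

lemma sqint_prim_le:
  assumes "G \<in> L2 {a<..<b}"
  shows "sqint {a<..<b} (prim {a<..<b} G) \<le> (b - a)\<^sup>2 * sqint {a<..<b} G"
proof -
  note c = continuous_prim[OF ab L2_integrable[OF ab assms]]
  let ?B = "sqrt ((b - a) * sqint {a<..<b} G)"
  have nn: "0 \<le> (b - a) * sqint {a<..<b} G" using ab sqint_nonneg by simp
  have "sqint {a<..<b} (prim {a<..<b} G) \<le> (b - a) * ?B\<^sup>2"
  proof (rule L2_bounded(2)[OF ab continuous_borel_measurable_interval[OF ab c]])
    fix x show "cmod (prim {a<..<b} G x) \<le> ?B"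
      using norm_prim_L2[OF assms, of x] real_le_rsqrt by blast
  qed
  then show ?thesis using nn by (simp add: power2_eq_square mult.assoc)
qed

text \<open>A test function \<psi> close to G has a small integral because G has mean zero. A
  multiple of a fixed test function \<rho> with nonzero integral removes it at small cost.\<close>

lemma test_functions_dense_mean_zero:
  assumes G: "G \<in> L2 {a<..<b}" and G0: "integral\<^sup>L (lebesgue_on {a<..<b}) G = 0" and e: "0 < e"
  obtains \<psi> where "\<psi> \<in> test_functions {a<..<b}" "integral\<^sup>L (lebesgue_on {a<..<b}) \<psi> = 0"
    "sqint {a<..<b} (\<lambda>x. G x - \<psi> x) < e"
proof -
  let ?J = "{a<..<b}" and ?I = "integral\<^sup>L (lebesgue_on {a<..<b})"
  have one: "(\<lambda>x. 1) \<in> L2 ?J" by (rule continuous_L2[OF ab]) simp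
  \<comment> \<open>Closeness to the constant 1 forces a nonzero integral: otherwise 1 - \<rho>
    would have integral b - a, hence squared norm at least b - a.\<close>
  obtain \<rho> where \<rho>: "\<rho> \<in> test_functions ?J" "sqint ?J (\<lambda>x. 1 - \<rho> x) < b - a"
    using test_functions_dense[OF ab one, of "b - a"] ab by auto
  note \<rho>2 = test_function_L2[OF ab \<rho>(1)]
  have \<rho>0: "?I \<rho> \<noteq> 0"
  proof
    assume "?I \<rho> = 0"
    then have "?I (\<lambda>x. 1 - \<rho> x) = of_real (b - a)"
      using L2_integrable[OF ab \<rho>2] by (simp add: measure_interval[OF ab] scaleR_conv_of_real)
    then have "(b - a)\<^sup>2 \<le> (b - a) * sqint ?J (\<lambda>x. 1 - \<rho> x)"
      using norm_integral_L2[OF L2_diff[OF one \<rho>2]] by (simp only: norm_of_real power2_abs)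
    also have "\<dots> < (b - a) * (b - a)" using \<rho>(2) ab by (intro mult_strict_left_mono) auto
    finally show False by (simp add: power2_eq_square)
  qed
  \<comment> \<open>The correction costs at most (b - a) \<open>sqint\<close> (\<rho> / integral of
    \<rho>) times the error of \<psi>, by \<open>norm_integral_L2\<close> applied to G - \<psi>. The
    triangle inequality doubles this cost and the error itself.\<close>
  define C where "C = 2 + 2 * ((b - a) * sqint ?J (\<lambda>x. \<rho> x / ?I \<rho>))"
  have C: "0 < C" using sqint_nonneg ab by (auto simp: C_def intro!: add_pos_nonneg)
  obtain \<psi> where \<psi>: "\<psi> \<in> test_functions ?J" "sqint ?J (\<lambda>x. G x - \<psi> x) < e / C"
    using test_functions_dense[OF ab G, of "e / C"] C e by auto
  note \<psi>2 = test_function_L2[OF ab \<psi>(1)]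
  define c where "c = - ?I \<psi> / ?I \<rho>"
  let ?\<psi> = "\<lambda>x. \<psi> x + c * \<rho> x"
  have t: "?\<psi> \<in> test_functions ?J"
    by (intro test_function_add test_function_smooth_mult \<psi>(1) \<rho>(1) smooth_const ab)
  have "?I ?\<psi> = 0"
    using L2_integrable[OF ab \<rho>2] L2_integrable[OF ab \<psi>2] \<rho>0 by (simp add: c_def)
  moreover have "sqint ?J (\<lambda>x. G x - ?\<psi> x) < e"
  proof -
    have i\<psi>: "?I (\<lambda>x. G x - \<psi> x) = - ?I \<psi>"
      using L2_integrable[OF ab G] L2_integrable[OF ab \<psi>2] G0 by simp
    have "sqint ?J (\<lambda>x. - c * \<rho> x) = (cmod (?I \<psi>))\<^sup>2 * sqint ?J (\<lambda>x. \<rho> x / ?I \<rho>)"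
      by (simp add: sqint_def c_def norm_mult norm_divide power_mult_distrib power_divide)
    also have "\<dots> \<le> ((b - a) * sqint ?J (\<lambda>x. G x - \<psi> x)) * sqint ?J (\<lambda>x. \<rho> x / ?I \<rho>)"
      using norm_integral_L2[OF L2_diff[OF G \<psi>2]] unfolding i\<psi>
      by (intro mult_right_mono sqint_nonneg) simp
    finally have "sqint ?J (\<lambda>x. (G x - \<psi> x) + (- c * \<rho> x)) \<le> C * sqint ?J (\<lambda>x. G x - \<psi> x)"
      using sqint_add_le[OF L2_diff[OF G \<psi>2] L2_cmult[OF \<rho>2, of "- c"]]
      by (simp add: C_def algebra_simps)
    also have "\<dots> < e" using \<psi>(2) C by (simp add: field_simps)
    finally show ?thesis by (simp add: algebra_simps)
  qed
  ultimately show ?thesis using that[OF t] by blast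
qed

text \<open>The primitives of mean-zero test functions \<psi> approximating G are test functions.
  They approximate \<phi> in the Sobolev norm, whose square is at most ((b - a)^2 + 1)
  \<open>sqint\<close> (G - \<psi>).\<close>

lemma W12_0I:
  assumes G: "G \<in> L2 {a<..<b}" and G0: "integral\<^sup>L (lebesgue_on {a<..<b}) G = 0"
    and \<phi>: "\<And>x. x \<in> {a..b} \<Longrightarrow> \<phi> x = prim {a<..<b} G x"
  shows "\<phi> \<in> W12_0 {a<..<b}"
proof -
  let ?J = "{a<..<b}"
  have "\<exists>\<psi>. \<psi> \<in> test_functions ?J \<and> integral\<^sup>L (lebesgue_on ?J) \<psi> = 0 \<and>
      sqint ?J (\<lambda>x. G x - \<psi> x) < inverse (real (Suc n))" for n
    by (rule test_functions_dense_mean_zero[OF G G0, of "inverse (real (Suc n))"]) auto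
  then obtain \<psi> where \<psi>: "\<And>n. \<psi> n \<in> test_functions ?J"
    "\<And>n. integral\<^sup>L (lebesgue_on ?J) (\<psi> n) = 0"
    "\<And>n. sqint ?J (\<lambda>x. G x - \<psi> n x) < inverse (real (Suc n))"
    by metis
  let ?K = "(b - a)\<^sup>2 + 1"
  have bound: "W12_norm ?J (\<lambda>x. \<phi> x - prim ?J (\<psi> n) x) \<le> sqrt (?K * inverse (real (Suc n)))" for n
  proof -
    let ?D = "\<lambda>x. G x - \<psi> n x"
    note \<psi>2 = test_function_L2[OF ab \<psi>(1)]
    note D = L2_diff[OF G \<psi>2, of n]
    have eq: "\<phi> x - prim ?J (\<psi> n) x = prim ?J ?D x" if "x \<in> {a..b}" for x
      using that \<phi> prim_diff[OF ab L2_integrable[OF ab G] L2_integrable[OF ab \<psi>2]] by simp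
    have wd: "has_weak_deriv ?J (\<lambda>x. \<phi> x - prim ?J (\<psi> n) x) ?D"
      by (rule W12_primI(2)[OF D, of _ 0]) (use eq in simp)
    have "sqint ?J (weak_deriv ?J (\<lambda>x. \<phi> x - prim ?J (\<psi> n) x)) = sqint ?J ?D"
      by (rule sqint_cong_AE[OF weak_deriv_AE_eq[OF D wd] D])
    moreover have "sqint ?J (\<lambda>x. \<phi> x - prim ?J (\<psi> n) x) = sqint ?J (prim ?J ?D)"
      by (rule sqint_cong) (use eq in simp)
    ultimately have "W12_norm ?J (\<lambda>x. \<phi> x - prim ?J (\<psi> n) x) \<le> sqrt (?K * sqint ?J ?D)"
      using sqint_prim_le[OF D] by (simp add: W12_norm_eq algebra_simps)
    also have "\<dots> \<le> sqrt (?K * inverse (real (Suc n)))"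
      using \<psi>(3)[of n] by (intro real_sqrt_le_mono mult_left_mono) auto
    finally show ?thesis .
  qed
  have lim: "(\<lambda>n. sqrt (?K * inverse (real (Suc n)))) \<longlonglongrightarrow> 0"
    using tendsto_real_sqrt[OF tendsto_mult[OF tendsto_const[of ?K] LIMSEQ_inverse_real_of_nat]] by simp
  have "(\<lambda>n. W12_norm ?J (\<lambda>x. \<phi> x - prim ?J (\<psi> n) x)) \<longlonglongrightarrow> 0"
  proof (rule tendsto_sandwich[OF always_eventually always_eventually tendsto_const lim])
    show "\<forall>n. 0 \<le> W12_norm ?J (\<lambda>x. \<phi> x - prim ?J (\<psi> n) x)"
      by (simp add: W12_norm_eq sqint_nonneg)
    show "\<forall>n. W12_norm ?J (\<lambda>x. \<phi> x - prim ?J (\<psi> n) x) \<le> sqrt (?K * inverse (real (Suc n)))"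
      using bound by blast
  qed
  moreover have "\<phi> \<in> W12 ?J" by (rule W12_primI(1)[OF G, of _ 0]) (use \<phi> in simp)
  ultimately show ?thesis
    using prim_test_function(1)[OF ab \<psi>(1,2)]
    by (auto simp: W12_0_def intro!: exI[of _ "\<lambda>n. prim ?J (\<psi> n)"])
qed

lemma sqint_eq_0_continuous:
  assumes c: "continuous_on {a..b} F" and 0: "sqint {a<..<b} F = 0" and x: "x \<in> {a..b}"
  shows "F x = 0"
proof -
  have c2: "continuous_on {a..b} (\<lambda>x. (cmod (F x))\<^sup>2)" by (intro continuous_intros c)
  have "integral {a..b} (\<lambda>x. (cmod (F x))\<^sup>2) = sqint {a<..<b} F"
    unfolding sqint_def
    by (subst lebesgue_integral_eq_integral)
      (use L2_integrable_square[OF continuous_L2[OF ab c]] integral_open_interval_real in auto)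
  then show ?thesis using integral_eq_0_iff[OF c2 ab] 0 x by simp
qed

text \<open>The converse of \<open>W12_0I\<close>. Test functions are primitives of their
  derivatives, which have mean zero; both facts survive the limit in L^2, and continuity turns the
  almost everywhere identity into one at every point.\<close>

lemma W12_0D:
  assumes "\<phi> \<in> W12_0 {a<..<b}"
  shows "weak_deriv {a<..<b} \<phi> \<in> L2 {a<..<b}"
    and "integral\<^sup>L (lebesgue_on {a<..<b}) (weak_deriv {a<..<b} \<phi>) = 0"
    and "\<And>x. x \<in> {a..b} \<Longrightarrow> \<phi> x = prim {a<..<b} (weak_deriv {a<..<b} \<phi>) x"
proof -
  let ?J = "{a<..<b}" let ?G = "weak_deriv ?J \<phi>" let ?W = "W12_norm ?J"
  obtain \<phi>' where \<phi>': "\<And>n. \<phi>' n \<in> test_functions ?J" "(\<lambda>n::nat. ?W (\<lambda>x. \<phi> x - \<phi>' n x)) \<longlonglongrightarrow> 0"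
    and \<phi>: "\<phi> \<in> W12 ?J"
    using assms by (auto simp: W12_0_def)
  have c\<phi>: "continuous_on {a..b} \<phi>" using \<phi> by (simp add: W12_def closure_interval)
  show G: "?G \<in> L2 ?J" by (rule weak_deriv_works(1)[OF \<phi>])
  let ?d = "\<lambda>n x. vector_derivative (\<phi>' n) (at x)"
  note d = test_function_L2[OF ab test_function_deriv[OF \<phi>'(1) ab]]
  note l2 = continuous_L2[OF ab c\<phi>] test_function_L2[OF ab \<phi>'(1)]
  note cP = continuous_prim[OF ab L2_integrable[OF ab G]]
  define c where "c n = (?W (\<lambda>x. \<phi> x - \<phi>' n x))\<^sup>2" for n
  have c: "c \<longlonglongrightarrow> 0" unfolding c_def using tendsto_power[OF \<phi>'(2), of 2] by simp
  have D: "(\<lambda>x. ?G x - ?d n x) \<in> L2 ?J" for n by (rule L2_diff[OF G d])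
  \<comment> \<open>\<open>weak_deriv\<close> of the difference is a chosen function, known only
    almost everywhere. \<open>sqint\<close> does not see the choice.\<close>
  have le: "sqint ?J (\<lambda>x. \<phi> x - \<phi>' n x) \<le> c n" "sqint ?J (\<lambda>x. ?G x - ?d n x) \<le> c n" for n
  proof -
    have wd': "has_weak_deriv ?J (\<phi>' n) (?d n)"
      by (rule has_weak_deriv_prim[OF ab L2_integrable[OF ab d], of _ 0])
        (simp add: prim_vector_derivative_test_function(1)[OF ab \<phi>'(1)])
    have "has_weak_deriv ?J (\<lambda>x. \<phi> x - \<phi>' n x) (\<lambda>x. ?G x - ?d n x)"
      unfolding has_weak_deriv_def
    proof
      fix \<theta> assume \<theta>: "\<theta> \<in> test_functions ?J"
      note \<theta>2 = test_function_L2[OF ab \<theta>] test_function_L2[OF ab test_function_deriv[OF \<theta> ab]]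
      show "(LINT x|lebesgue_on ?J. (\<phi> x - \<phi>' n x) * vector_derivative \<theta> (at x)) =
        - (LINT x|lebesgue_on ?J. (?G x - ?d n x) * \<theta> x)"
        using L2_mult_integrable(1)[OF l2(1) \<theta>2(2)] L2_mult_integrable(1)[OF l2(2)[of n] \<theta>2(2)]
          L2_mult_integrable(1)[OF G \<theta>2(1)] L2_mult_integrable(1)[OF d[of n] \<theta>2(1)]
          weak_deriv_works(2)[OF \<phi>] wd' \<theta>
        by (simp add: left_diff_distrib has_weak_deriv_def)
    qed
    from sqint_cong_AE[OF weak_deriv_AE_eq[OF D this] D]
    have "sqint ?J (weak_deriv ?J (\<lambda>x. \<phi> x - \<phi>' n x)) = sqint ?J (\<lambda>x. ?G x - ?d n x)" .
    then show "sqint ?J (\<lambda>x. \<phi> x - \<phi>' n x) \<le> c n" "sqint ?J (\<lambda>x. ?G x - ?d n x) \<le> c n"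
      using sqint_le_W12_norm[of ?J "\<lambda>x. \<phi> x - \<phi>' n x"] by (simp_all add: c_def)
  qed
  show "integral\<^sup>L (lebesgue_on ?J) ?G = 0"
  proof -
    have "(cmod (integral\<^sup>L (lebesgue_on ?J) ?G))\<^sup>2 \<le> (b - a) * c n" for n
    proof -
      have "integral\<^sup>L (lebesgue_on ?J) ?G = integral\<^sup>L (lebesgue_on ?J) (\<lambda>x. ?G x - ?d n x)"
        using L2_integrable[OF ab G] L2_integrable[OF ab d]
          prim_vector_derivative_test_function(2)[OF ab \<phi>'(1)] by simp
      then have "(cmod (integral\<^sup>L (lebesgue_on ?J) ?G))\<^sup>2 \<le> (b - a) * sqint ?J (\<lambda>x. ?G x - ?d n x)"
        using norm_integral_L2[OF D[of n]] by simp
      also have "\<dots> \<le> (b - a) * c n" using le(2) ab by (intro mult_left_mono) auto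
      finally show ?thesis .
    qed
    then have "(cmod (integral\<^sup>L (lebesgue_on ?J) ?G))\<^sup>2 \<le> (b - a) * 0"
      by (intro LIMSEQ_le_const[OF tendsto_mult[OF tendsto_const c]]) auto
    then show ?thesis by simp
  qed
  have "sqint ?J (\<lambda>x. \<phi> x - prim ?J ?G x) \<le> (2 + 2 * (b - a)\<^sup>2) * c n" for n
  proof -
    have "sqint ?J (\<lambda>x. \<phi>' n x - prim ?J ?G x) = sqint ?J (prim ?J (\<lambda>x. ?G x - ?d n x))"
      unfolding prim_diff[OF ab L2_integrable[OF ab G] L2_integrable[OF ab d]]
        prim_vector_derivative_test_function(1)[OF ab \<phi>'(1)]
      by (simp add: sqint_def norm_minus_commute prim_diff[OF ab L2_integrable[OF ab G] L2_integrable[OF ab d]]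
          prim_vector_derivative_test_function(1)[OF ab \<phi>'(1)])
    also have "\<dots> \<le> (b - a)\<^sup>2 * sqint ?J (\<lambda>x. ?G x - ?d n x)" by (rule sqint_prim_le[OF D])
    also have "\<dots> \<le> (b - a)\<^sup>2 * c n" using le(2) by (intro mult_left_mono) auto
    finally show ?thesis
      using sqint_diff_triangle[OF l2(1) l2(2)[of n] continuous_L2[OF ab cP]] le(1)[of n]
      by (simp add: algebra_simps)
  qed
  then have "sqint ?J (\<lambda>x. \<phi> x - prim ?J ?G x) \<le> (2 + 2 * (b - a)\<^sup>2) * 0"
    by (intro LIMSEQ_le_const[OF tendsto_mult[OF tendsto_const c]]) auto
  then have 0: "sqint ?J (\<lambda>x. \<phi> x - prim ?J ?G x) = 0"
    using sqint_nonneg[of ?J "\<lambda>x. \<phi> x - prim ?J ?G x"] by simp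
  fix x assume "x \<in> {a..b}"
  from sqint_eq_0_continuous[OF _ 0 this] show "\<phi> x = prim ?J ?G x"
    using c\<phi> cP by (auto intro: continuous_intros)
qed

text \<open>The Sobolev embedding into bounded functions; it makes integration against a finite
  measure a bounded functional.\<close>

lemma W12_0_bound:
  assumes "\<phi> \<in> W12_0 {a<..<b}" "x \<in> {a..b}"
  shows "cmod (\<phi> x) \<le> sqrt (b - a) * W12_norm {a<..<b} \<phi>"
proof -
  let ?J = "{a<..<b}"
  have "(cmod (\<phi> x))\<^sup>2 \<le> (b - a) * sqint ?J (weak_deriv ?J \<phi>)"
    using norm_prim_L2[OF W12_0D(1)[OF assms(1)], of x] W12_0D(3)[OF assms] by simp
  also have "\<dots> \<le> (b - a) * (W12_norm ?J \<phi>)\<^sup>2"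
    using ab sqint_le_W12_norm by (intro mult_left_mono) auto
  also have "\<dots> = (sqrt (b - a) * W12_norm ?J \<phi>)\<^sup>2" using ab by (simp add: power_mult_distrib)
  finally show ?thesis
    by (rule power2_le_imp_le) (use ab sqint_nonneg in \<open>auto simp: W12_norm_eq\<close>)
qed

lemma W12_0_continuous: "\<phi> \<in> W12_0 {a<..<b} \<Longrightarrow> continuous_on {a..b} \<phi>"
  by (simp add: W12_0_def W12_def closure_interval)

lemma W12_0_add:
  assumes "\<phi> \<in> W12_0 {a<..<b}" "\<psi> \<in> W12_0 {a<..<b}"
  shows "(\<lambda>x. \<phi> x + \<psi> x) \<in> W12_0 {a<..<b}"
proof (rule W12_0I)
  note 1 = W12_0D[OF assms(1)] and 2 = W12_0D[OF assms(2)]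
  let ?G = "\<lambda>x. weak_deriv {a<..<b} \<phi> x + weak_deriv {a<..<b} \<psi> x"
  show "?G \<in> L2 {a<..<b}" by (rule L2_add[OF 1(1) 2(1)])
  show "integral\<^sup>L (lebesgue_on {a<..<b}) ?G = 0"
    using L2_integrable[OF ab 1(1)] L2_integrable[OF ab 2(1)] 1(2) 2(2) by simp
  show "\<phi> x + \<psi> x = prim {a<..<b} ?G x" if "x \<in> {a..b}" for x
    using prim_add[OF ab L2_integrable[OF ab 1(1)] L2_integrable[OF ab 2(1)]] 1(3)[OF that] 2(3)[OF that]
    by simp
qed

lemma W12_0_cmult:
  assumes "\<phi> \<in> W12_0 {a<..<b}"
  shows "(\<lambda>x. c * \<phi> x) \<in> W12_0 {a<..<b}"
proof (rule W12_0I)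
  note 1 = W12_0D[OF assms]
  let ?G = "\<lambda>x. c * weak_deriv {a<..<b} \<phi> x"
  show "?G \<in> L2 {a<..<b}" by (rule L2_cmult[OF 1(1)])
  show "integral\<^sup>L (lebesgue_on {a<..<b}) ?G = 0" using 1(2) by simp
  show "c * \<phi> x = prim {a<..<b} ?G x" if "x \<in> {a..b}" for x
    using 1(3)[OF that] prim_cmult[OF ab] by simp
qed

text \<open>\<open>S_op\<close> evaluates q at f \<phi>, so this product must lie in the domain of
  q. The product rule writes it as a primitive of an L^2 function whose mean is zero because \<phi>
  vanishes at b.\<close>

lemma W12_0_mult:
  assumes g: "g \<in> L2 {a<..<b}" and f: "\<And>x. x \<in> {a..b} \<Longrightarrow> f x = f\<^sub>0 + prim {a<..<b} g x"
    and \<phi>: "\<phi> \<in> W12_0 {a<..<b}"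
  shows "(\<lambda>x. f x * \<phi> x) \<in> W12_0 {a<..<b}"
proof -
  let ?J = "{a<..<b}"
  let ?h = "weak_deriv ?J \<phi>"
  note h = W12_0D(1)[OF \<phi>]
  have bdd: "(\<lambda>t. F t * prim ?J H t) \<in> L2 ?J" if F: "F \<in> L2 ?J" and H: "H \<in> L2 ?J" for F H
  proof -
    let ?B = "(b - a) * sqint ?J H"
    note [measurable] = L2_measurable[OF F] 
      continuous_borel_measurable_interval[OF ab continuous_prim[OF ab L2_integrable[OF ab H]]]
    have "integrable (lebesgue_on ?J) (\<lambda>t. ?B * (cmod (F t))\<^sup>2)"
      using L2_integrable_square[OF F] by simp
    moreover have "(cmod (F t * prim ?J H t))\<^sup>2 \<le> ?B * (cmod (F t))\<^sup>2" for t
      using mult_right_mono[OF norm_prim_L2[OF H, of t], of "(cmod (F t))\<^sup>2"]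
      by (simp add: norm_mult power_mult_distrib mult.commute)
    ultimately have "integrable (lebesgue_on ?J) (\<lambda>t. (cmod (F t * prim ?J H t))\<^sup>2)"
      by (elim Bochner_Integration.integrable_bound) (auto intro!: AE_I2 intro: order_trans[OF _ abs_ge_self])
    then show ?thesis by (simp add: L2_def)
  qed
  have "(\<lambda>x. prim ?J g x * \<phi> x) \<in> W12_0 ?J"
  proof (rule W12_0I)
    let ?G = "\<lambda>t. g t * prim ?J ?h t + prim ?J g t * ?h t"
    show "?G \<in> L2 ?J"
      using L2_add[OF bdd[OF g h] bdd[OF h g]] by (simp add: mult.commute)
    note P = prim_mult[OF ab L2_integrable[OF ab g] L2_integrable[OF ab h]]
    show "integral\<^sup>L (lebesgue_on ?J) ?G = 0"
      using P[of b] W12_0D(2)[OF \<phi>] prim_right[OF ab, of b ?G] prim_right[OF ab, of b ?h] by simp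
    show "prim ?J g x * \<phi> x = prim ?J ?G x" if "x \<in> {a..b}" for x
      using P[of x] W12_0D(3)[OF \<phi> that] by simp
  qed
  from W12_0_add[OF W12_0_cmult[OF \<phi>, of f\<^sub>0] this]
  have *: "(\<lambda>x. f\<^sub>0 * \<phi> x + prim ?J g x * \<phi> x) \<in> W12_0 ?J" .
  note 1 = W12_0D[OF *]
  show ?thesis by (rule W12_0I[OF 1(1,2)]) (use 1(3) f in \<open>simp add: distrib_right\<close>)
qed

end

section \<open>Complex measures as combinations of finite measures\<close>

locale real_charge =
  fixes X :: "real set" and s :: "real set \<Rightarrow> real"
  assumes countably_additive: "\<And>A :: nat \<Rightarrow> real set. range A \<subseteq> sets (restrict_space borel X) \<Longrightarrow>
    disjoint_family A \<Longrightarrow> (\<lambda>n. s (A n)) sums s (\<Union>n. A n)"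
begin

abbreviation "\<Sigma> \<equiv> sets (restrict_space borel X)"

lemma empty: "s {} = 0"
proof -
  have "(\<lambda>n::nat. s {}) sums s (\<Union>n::nat. {})"
    by (rule countably_additive) (auto simp: disjoint_family_on_def)
  then show ?thesis using sums_summable summable_const_iff by blast
qed

lemma additive: "A \<in> \<Sigma> \<Longrightarrow> B \<in> \<Sigma> \<Longrightarrow> A \<inter> B = {} \<Longrightarrow> s (A \<union> B) = s A + s B"
proof -
  assume AB: "A \<in> \<Sigma>" "B \<in> \<Sigma>" "A \<inter> B = {}"
  have "disjoint_family (binaryset A B)"
    using AB(3) by (simp add: disjoint_family_on_def binaryset_def) blast
  then have "(\<lambda>n. s (binaryset A B n)) sums s (A \<union> B)"
    using countably_additive[of "binaryset A B"] AB by (simp add: range_binaryset_eq UN_binaryset_eq)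
  moreover have "(\<lambda>n. s (binaryset A B n)) sums (s A + s B)"
    by (rule binaryset_sums[of s, OF empty])
  ultimately show ?thesis by (rule sums_unique2)
qed

lemma sets_pos_variation: "sets (pos_variation X s) = \<Sigma>"
  and space_pos_variation: "space (pos_variation X s) = X"
proof -
  interpret sigma_algebra X \<Sigma>
    using sets.sigma_algebra_axioms[of "restrict_space borel X"] by (simp add: space_restrict_space)
  show "sets (pos_variation X s) = \<Sigma>" "space (pos_variation X s) = X"
    by (simp_all add: pos_variation_def space_measure_of_eq sets_measure_of_eq)
qed

text \<open>If the positive variation were infinite, repeated splitting would yield disjoint sets
  whose charges stay away from zero.\<close>

lemma finite_measure_pos_variation: "finite_measure (pos_variation X s)"
proof (rule finite_measureI, rule notI)
  define f where "f A = (SUP B\<in>{B \<in> \<Sigma>. B \<subseteq> A}. ennreal (s B))" for A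
  let ?M = "pos_variation X s"
  have M: "?M = measure_of X \<Sigma> f" unfolding pos_variation_def f_def ..
  assume "emeasure ?M (space ?M) = \<infinity>"
  then have inf: "emeasure ?M X = \<infinity>" by (simp add: space_pos_variation)
  \<comment> \<open>\<open>measure_of\<close> yields the zero measure unless the set function is a
    genuine measure. The assumed infinite mass rules this default out, so the supremum formula is
    available together with additivity.\<close>
  have em: "emeasure ?M A = f A" if "A \<in> \<Sigma>" for A
    using inf that sets_pos_variation unfolding M emeasure_measure_of_conv
    by (auto split: if_splits)
  have split: "\<exists>E'. (E' \<in> \<Sigma> \<and> emeasure ?M E' = \<infinity>) \<and> E' \<subseteq> E \<and> 1 \<le> \<bar>s (E - E')\<bar>"
    if E: "E \<in> \<Sigma> \<and> emeasure ?M E = \<infinity>" for E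
  proof -
    have "f E = top" using E em by (metis infinity_ennreal_def)
    \<comment> \<open>A subset A with charge above |s E| + 1 leaves a remainder of charge below -1.
      Whichever of the two pieces has infinite measure is kept, and the discarded one has charge of
      modulus at least 1.\<close>
    then have "ennreal (\<bar>s E\<bar> + 1) < f E" by (metis ennreal_less_top)
    then obtain A where A: "A \<in> \<Sigma>" "A \<subseteq> E" "ennreal (\<bar>s E\<bar> + 1) < ennreal (s A)"
      unfolding f_def less_SUP_iff by auto
    have sA: "\<bar>s E\<bar> + 1 < s A" using A(3) by (subst (asm) ennreal_less_iff) auto
    have EA: "E - A \<in> \<Sigma>" using E A(1) by blast
    have "s E = s A + s (E - A)" using additive[OF A(1) EA] A(2) by (simp add: Un_absorb1)
    then have sEA: "s (E - A) \<le> - 1" using sA by linarith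
    have "emeasure ?M A + emeasure ?M (E - A) = emeasure ?M E"
      using A(1,2) EA sets_pos_variation plus_emeasure[of A ?M "E - A"] by (simp add: Un_absorb1)
    then consider "emeasure ?M A = \<infinity>" | "emeasure ?M (E - A) = \<infinity>"
      using E by auto
    then show ?thesis
    proof cases
      case 1
      then show ?thesis using A sEA by (intro exI[of _ A]) auto
    next
      case 2
      have "E - (E - A) = A" using A(2) by blast
      then show ?thesis using 2 EA sA by (intro exI[of _ "E - A"]) auto
    qed
  qed
  have X: "X \<in> \<Sigma>" using sets.top[of "restrict_space borel X"] by (simp add: space_restrict_space)
  have "\<exists>E. \<forall>n. (E n \<in> \<Sigma> \<and> emeasure ?M (E n) = \<infinity>) \<and> (E (Suc n) \<subseteq> E n \<and> 1 \<le> \<bar>s (E n - E (Suc n))\<bar>)"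
    by (rule dependent_nat_choice) (use inf X split in auto)
  then obtain E where E: "\<And>n. E n \<in> \<Sigma>" "\<And>n. E (Suc n) \<subseteq> E n" "\<And>n. 1 \<le> \<bar>s (E n - E (Suc n))\<bar>"
    by blast
  have mono: "E n \<subseteq> E m" if "m \<le> n" for m n using lift_Suc_antimono_le[of E, OF E(2) that] .
  have "(E m - E (Suc m)) \<inter> (E n - E (Suc n)) = {}" if "m < n" for m n
    using mono[of "Suc m" n] that by auto
  then have "disjoint_family (\<lambda>n. E n - E (Suc n))"
    unfolding disjoint_family_on_def by (metis Int_commute nat_neq_iff)
  then have "(\<lambda>n. s (E n - E (Suc n))) sums s (\<Union>n. E n - E (Suc n))"
    by (rule countably_additive[rotated]) (use E(1) in blast)
  then have "(\<lambda>n. \<bar>s (E n - E (Suc n))\<bar>) \<longlonglongrightarrow> 0"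
    by (intro tendsto_rabs_zero summable_LIMSEQ_zero sums_summable)
  then have "1 \<le> (0::real)" by (rule LIMSEQ_le_const) (use E(3) in auto)
  then show False by simp
qed

end

text \<open>From here on \<mu> is seen only as a finite combination of finite positive measures on
  J.\<close>

lemma complex_measure_integral_decomposition:
  assumes \<mu>: "complex_borel_measure X \<mu>" and J: "J \<in> sets borel" "J \<subseteq> X"
  obtains N :: "nat \<Rightarrow> real measure" and c :: "nat \<Rightarrow> complex" where
    "\<And>k. finite_measure (N k)" "\<And>k. (\<lambda>x. x) \<in> borel_measurable (N k)" "\<And>k. space (N k) = J"
    "\<And>k. cmod (c k) \<le> 1"
    "\<And>\<phi>. complex_measure_integral X \<mu> J \<phi> = (\<Sum>k<4. c k * (LINT x|N k. \<phi> x))"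
proof -
  have charge: "real_charge X (\<lambda>B. Re (\<mu> B))" "real_charge X (\<lambda>B. - Re (\<mu> B))"
    "real_charge X (\<lambda>B. Im (\<mu> B))" "real_charge X (\<lambda>B. - Im (\<mu> B))"
    using \<mu> unfolding real_charge_def complex_borel_measure_def
    by (intro allI impI sums_minus sums_Re sums_Im; blast)+
  \<comment> \<open>Reduction modulo 4 extends the four measures and coefficients to all indices, so
    that their properties hold for every k.\<close>
  define s where "s k = [\<lambda>B. Re (\<mu> B), \<lambda>B. - Re (\<mu> B), \<lambda>B. Im (\<mu> B), \<lambda>B. - Im (\<mu> B)] ! (k mod 4)" for k
  define c where "c k = [1, - 1, \<i>, - \<i>] ! (k mod 4)" for k
  define N where "N k = restrict_space (pos_variation X (s k)) J" for k
  have mod4: "k mod 4 = 0 \<or> k mod 4 = 1 \<or> k mod 4 = 2 \<or> k mod 4 = 3" for k :: nat by linarith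
  have ch: "real_charge X (s k)" for k
    using charge mod4[of k] by (auto simp: s_def)
  note sets = real_charge.sets_pos_variation[OF ch] and space = real_charge.space_pos_variation[OF ch]
  have fin: "finite_measure (N k)" for k
    unfolding N_def by (rule finite_measure_restrict_space[OF real_charge.finite_measure_pos_variation[OF ch]])
      (use J in \<open>auto simp: sets sets_restrict_space\<close>)
  have Jin: "J \<inter> Sigma_Algebra.space (pos_variation X (s k)) \<in> Sigma_Algebra.sets (pos_variation X (s k))" for k
    using J by (auto simp: sets space sets_restrict_space)
  show ?thesis
  proof (rule that[of N c])
    show "finite_measure (N k)" for k by (rule fin)
    show "(\<lambda>x. x) \<in> borel_measurable (N k)" for k
    proof -
      have "(\<lambda>x. x) \<in> borel_measurable (restrict_space borel X)"
        by (intro measurable_restrict_space1) simp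
      then have "(\<lambda>x. x) \<in> borel_measurable (pos_variation X (s k))"
        using measurable_cong_sets[OF sets refl] by blast
      then show ?thesis unfolding N_def by (rule measurable_restrict_space1)
    qed
    show "Sigma_Algebra.space (N k) = J" for k
      using J by (auto simp: N_def space_restrict_space space)
    show "cmod (c k) \<le> 1" for k
      using mod4[of k] by (auto simp: c_def)
    fix \<phi> :: "real \<Rightarrow> complex"
    have "(LINT x:J|pos_variation X (s k). \<phi> x) = (LINT x|N k. \<phi> x)" for k
      unfolding N_def set_lebesgue_integral_def by (rule integral_restrict_space[OF Jin, symmetric])
    note int = this[of 0] this[of 1] this[of 2] this[of 3]
    have s0123: "s 0 = (\<lambda>B. Re (\<mu> B))" "s 1 = (\<lambda>B. - Re (\<mu> B))"
      "s 2 = (\<lambda>B. Im (\<mu> B))" "s 3 = (\<lambda>B. - Im (\<mu> B))"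
      by (simp_all add: s_def)
    have c0123: "c 0 = 1" "c 1 = - 1" "c 2 = \<i>" "c 3 = - \<i>"
      by (simp_all add: c_def)
    have sum4: "(\<Sum>k<4. F k) = F 0 + F 1 + F 2 + F 3" for F :: "nat \<Rightarrow> complex"
      by (simp add: eval_nat_numeral)
    show "complex_measure_integral X \<mu> J \<phi> = (\<Sum>k<4. c k * (LINT x|N k. \<phi> x))"
      unfolding sum4 c0123 complex_measure_integral_def int[unfolded s0123]
      by (simp add: right_diff_distrib)
  qed
qed

section \<open>The integral equation\<close>

locale measure_combination =
  fixes a b :: real and m :: nat and N :: "nat \<Rightarrow> real measure" and c :: "nat \<Rightarrow> complex"
  assumes ab: "a < b"
    and fin: "\<And>k. finite_measure (N k)"
    and idN: "\<And>k. (\<lambda>x. x) \<in> borel_measurable (N k)"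
    and space: "\<And>k. space (N k) = {a<..<b}"
    and c: "\<And>k. cmod (c k) \<le> 1"
begin

section \<open>The functional given by a combination of measures\<close>

definition I :: "(real \<Rightarrow> complex) \<Rightarrow> complex" where
  "I \<phi> = (\<Sum>k<m. c k * (LINT x|N k. \<phi> x))"

definition mass :: real where
  "mass = (\<Sum>k<m. measure (N k) {a<..<b})"

text \<open>A class of integrands stable under sums and products and integrable for every
  \<open>N k\<close>, so that \<open>I\<close> is linear on it.\<close>

definition bdd_meas :: "(real \<Rightarrow> complex) \<Rightarrow> bool" where
  "bdd_meas \<phi> \<longleftrightarrow> (\<forall>k. \<phi> \<in> borel_measurable (N k)) \<and> bounded (\<phi> ` {a<..<b})"

lemma mass_nonneg: "0 \<le> mass"
  by (simp add: mass_def sum_nonneg)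

lemma bdd_meas_integrable:
  assumes "bdd_meas \<phi>"
  shows "integrable (N k) \<phi>"
proof -
  interpret finite_measure "N k" by (rule fin)
  obtain B where "\<forall>x\<in>{a<..<b}. cmod (\<phi> x) \<le> B"
    using assms by (auto simp: bdd_meas_def bounded_iff)
  then show ?thesis
    using assms by (intro integrable_const_bound[of _ B]) (auto simp: bdd_meas_def space intro!: AE_I2)
qed

lemma bdd_meas_add: "bdd_meas \<phi> \<Longrightarrow> bdd_meas \<psi> \<Longrightarrow> bdd_meas (\<lambda>x. \<phi> x + \<psi> x)"
  unfolding bdd_meas_def using bounded_plus_comp[of \<phi> "{a<..<b}" \<psi>] by (auto intro: borel_measurable_add)

lemma bdd_meas_mult:
  assumes "bdd_meas \<phi>" "bdd_meas \<psi>"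
  shows "bdd_meas (\<lambda>x. \<phi> x * \<psi> x)"
proof -
  obtain B C where "\<forall>x\<in>{a<..<b}. cmod (\<phi> x) \<le> B" "\<forall>x\<in>{a<..<b}. cmod (\<psi> x) \<le> C"
    using assms by (auto simp: bdd_meas_def bounded_iff)
  then have "\<forall>x\<in>{a<..<b}. cmod (\<phi> x * \<psi> x) \<le> B * C"
    by (auto simp: norm_mult intro!: mult_mono intro: order_trans[OF norm_ge_zero])
  then show ?thesis using assms unfolding bdd_meas_def bounded_iff
    by (auto intro: borel_measurable_times)
qed

lemma bdd_meas_continuous:
  assumes "continuous_on {a..b} \<phi>"
  shows "bdd_meas \<phi>"
proof -
  \<comment> \<open>Measurability for \<open>N k\<close> is inherited from Borel functions on the
    whole line, so \<phi> is extended by clamping its argument.\<close>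
  define \<psi> where "\<psi> x = \<phi> (max a (min b x))" for x
  have "continuous_on UNIV \<psi>"
    unfolding \<psi>_def by (rule continuous_on_compose2[OF assms]) (use ab in \<open>auto intro!: continuous_intros\<close>)
  from measurable_compose[OF idN borel_measurable_continuous_onI[OF this]]
  have "\<psi> \<in> borel_measurable (N k)" for k .
  moreover have "\<phi> \<in> borel_measurable (N k) \<longleftrightarrow> \<psi> \<in> borel_measurable (N k)" for k
    by (rule measurable_cong) (auto simp: space \<psi>_def)
  moreover have "bounded (\<phi> ` {a<..<b})"
    by (rule bounded_subset[OF compact_imp_bounded[OF compact_continuous_image[OF assms compact_Icc]]]) auto
  ultimately show ?thesis by (simp add: bdd_meas_def)
qed

lemma bdd_meas_const: "bdd_meas (\<lambda>x. z)"
  by (rule bdd_meas_continuous) simp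

lemma bdd_meas_less: "bdd_meas (\<lambda>x. of_bool (x < t))"
proof -
  note [measurable] = idN
  show ?thesis unfolding bdd_meas_def
    by (auto simp: bounded_iff intro!: exI[of _ 1])
qed

lemma I_add: "bdd_meas \<phi> \<Longrightarrow> bdd_meas \<psi> \<Longrightarrow> I (\<lambda>x. \<phi> x + \<psi> x) = I \<phi> + I \<psi>"
  by (simp add: I_def bdd_meas_integrable distrib_left sum.distrib)

lemma I_cmult: "I (\<lambda>x. z * \<phi> x) = z * I \<phi>"
  by (simp add: I_def sum_distrib_left mult.left_commute)

lemma I_diff: "bdd_meas \<phi> \<Longrightarrow> bdd_meas \<psi> \<Longrightarrow> I (\<lambda>x. \<phi> x - \<psi> x) = I \<phi> - I \<psi>"
  by (simp add: I_def bdd_meas_integrable right_diff_distrib sum_subtractf)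

lemma I_cong: "(\<And>x. x \<in> {a<..<b} \<Longrightarrow> \<phi> x = \<psi> x) \<Longrightarrow> I \<phi> = I \<psi>"
  unfolding I_def by (intro sum.cong refl arg_cong2[where f = "(*)"] Bochner_Integration.integral_cong)
    (auto simp: space)

lemma norm_I_le:
  assumes \<phi>: "\<And>x. x \<in> {a<..<b} \<Longrightarrow> cmod (\<phi> x) \<le> B" and B: "0 \<le> B"
  shows "cmod (I \<phi>) \<le> mass * B"
proof -
  have "cmod (c k * (LINT x|N k. \<phi> x)) \<le> measure (N k) {a<..<b} * B" for k
  proof -
    interpret finite_measure "N k" by (rule fin)
    have "cmod (LINT x|N k. \<phi> x) \<le> (LINT x|N k. cmod (\<phi> x))" by (rule integral_norm_bound)
    also have "\<dots> \<le> (LINT x|N k. B)"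
      using \<phi> B by (intro integral_mono') (auto simp: space)
    also have "\<dots> = measure (N k) {a<..<b} * B" by (simp add: space)
    finally have "cmod (c k) * cmod (LINT x|N k. \<phi> x) \<le> 1 * (measure (N k) {a<..<b} * B)"
      by (intro mult_mono c) auto
    then show ?thesis by (simp add: norm_mult)
  qed
  then have "(\<Sum>k<m. cmod (c k * (LINT x|N k. \<phi> x))) \<le> mass * B"
    unfolding mass_def sum_distrib_right by (intro sum_mono)
  then show ?thesis unfolding I_def by (rule order_trans[OF norm_sum])
qed

lemma norm_I_diff_le:
  assumes "bdd_meas \<phi>" "bdd_meas \<psi>" "\<And>x. x \<in> {a<..<b} \<Longrightarrow> cmod (\<phi> x - \<psi> x) \<le> B" "0 \<le> B"
  shows "cmod (I \<phi> - I \<psi>) \<le> mass * B"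
  using norm_I_le[of "\<lambda>x. \<phi> x - \<psi> x" B] assms by (simp add: I_diff)

text \<open>The length of the interval from s to x, or 0 if s >= x. Integrating a measure twice from
  the left end amounts to integrating this kernel against it.\<close>

definition volterra :: "real \<Rightarrow> real \<Rightarrow> complex" where
  "volterra x s = of_real (max (x - s) 0)"

lemma volterra_lipschitz: "cmod (volterra x s - volterra y s) \<le> \<bar>x - y\<bar>"
  unfolding volterra_def of_real_diff[symmetric] norm_of_real by (auto simp: max_def)

lemma bdd_meas_volterra: "bdd_meas (volterra x)"
  unfolding volterra_def by (intro bdd_meas_continuous continuous_intros)

definition solution :: "complex \<Rightarrow> complex \<Rightarrow> (real \<Rightarrow> complex) \<Rightarrow> bool" where
  "solution \<alpha> \<beta> f \<longleftrightarrow> continuous_on {a..b} f \<and>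
     (\<forall>x\<in>{a..b}. f x = \<alpha> + \<beta> * of_real (x - a) + I (\<lambda>s. volterra x s * f s))"

text \<open>The derivative of a solution with left-sided convention: the strict s < t omits an atom
  at t. Together with the value of f it forms the Cauchy data at t.\<close>

definition quasi_deriv :: "complex \<Rightarrow> (real \<Rightarrow> complex) \<Rightarrow> real \<Rightarrow> complex" where
  "quasi_deriv \<beta> f t = \<beta> + I (\<lambda>s. of_bool (s < t) * f s)"

lemma solution_bdd: "solution \<alpha> \<beta> f \<Longrightarrow> bdd_meas f"
  by (simp add: solution_def bdd_meas_continuous)

lemma solution_lincomb:
  assumes f: "solution \<alpha> \<beta> f" and g: "solution \<gamma> \<delta> g"
  shows "solution (z * \<alpha> + w * \<gamma>) (z * \<beta> + w * \<delta>) (\<lambda>x. z * f x + w * g x)"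
    and "quasi_deriv (z * \<beta> + w * \<delta>) (\<lambda>x. z * f x + w * g x) t = z * quasi_deriv \<beta> f t + w * quasi_deriv \<delta> g t"
proof -
  have I: "I (\<lambda>s. k s * (z * f s + w * g s)) = z * I (\<lambda>s. k s * f s) + w * I (\<lambda>s. k s * g s)"
    if "bdd_meas k" for k
  proof -
    have "I (\<lambda>s. k s * (z * f s + w * g s)) = I (\<lambda>s. z * (k s * f s) + w * (k s * g s))"
      by (simp add: algebra_simps)
    also have "\<dots> = z * I (\<lambda>s. k s * f s) + w * I (\<lambda>s. k s * g s)"
      using that solution_bdd[OF f] solution_bdd[OF g]
      by (subst I_add) (auto intro!: bdd_meas_mult bdd_meas_const simp: I_cmult)
    finally show ?thesis .
  qed
  have alg: "z * (\<alpha> + \<beta> * r + F) + w * (\<gamma> + \<delta> * r + G)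
      = (z * \<alpha> + w * \<gamma>) + (z * \<beta> + w * \<delta>) * r + (z * F + w * G)" for r F G
    by (simp add: algebra_simps)
  have "z * f x + w * g x = (z * \<alpha> + w * \<gamma>) + (z * \<beta> + w * \<delta>) * of_real (x - a)
      + I (\<lambda>s. volterra x s * (z * f s + w * g s))" if "x \<in> {a..b}" for x
  proof -
    have "f x = \<alpha> + \<beta> * of_real (x - a) + I (\<lambda>s. volterra x s * f s)"
      "g x = \<gamma> + \<delta> * of_real (x - a) + I (\<lambda>s. volterra x s * g s)"
      using f g that unfolding solution_def by blast+
    from arg_cong2[where f = "\<lambda>u v. z * u + w * v", OF this] show ?thesis
      unfolding I[OF bdd_meas_volterra] alg .
  qed
  then show "solution (z * \<alpha> + w * \<gamma>) (z * \<beta> + w * \<delta>) (\<lambda>x. z * f x + w * g x)"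
    using f g unfolding solution_def by (intro conjI ballI continuous_intros) blast+
  show "quasi_deriv (z * \<beta> + w * \<delta>) (\<lambda>x. z * f x + w * g x) t = z * quasi_deriv \<beta> f t + w * quasi_deriv \<delta> g t"
    unfolding quasi_deriv_def I[OF bdd_meas_less] by (simp add: algebra_simps)
qed

lemma solution_lipschitz:
  assumes f: "solution \<alpha> \<beta> f"
  obtains B where "\<And>x y. x \<in> {a..b} \<Longrightarrow> y \<in> {a..b} \<Longrightarrow> cmod (f x - f y) \<le> B * \<bar>x - y\<bar>"
proof -
  have fb: "bdd_meas f" by (rule solution_bdd[OF f])
  obtain C where "\<forall>x\<in>{a<..<b}. cmod (f x) \<le> C"
    using fb by (auto simp: bdd_meas_def bounded_iff)
  then have C: "cmod (f x) \<le> max C 0" if "x \<in> {a<..<b}" for x using that by fastforce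
  have "cmod (f x - f y) \<le> (cmod \<beta> + mass * max C 0) * \<bar>x - y\<bar>" if "x \<in> {a..b}" "y \<in> {a..b}" for x y
  proof -
    have eq: "f x - f y = \<beta> * of_real (x - y) + (I (\<lambda>s. volterra x s * f s) - I (\<lambda>s. volterra y s * f s))"
    proof -
      have "f x = \<alpha> + \<beta> * of_real (x - a) + I (\<lambda>s. volterra x s * f s)"
        "f y = \<alpha> + \<beta> * of_real (y - a) + I (\<lambda>s. volterra y s * f s)"
        using f that unfolding solution_def by blast+
      from arg_cong2[where f = minus, OF this] show ?thesis by (simp add: algebra_simps)
    qed
    have "cmod (I (\<lambda>s. volterra x s * f s) - I (\<lambda>s. volterra y s * f s)) \<le> mass * (\<bar>x - y\<bar> * max C 0)"
      using C volterra_lipschitz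
      by (intro norm_I_diff_le bdd_meas_mult bdd_meas_volterra fb)
        (auto simp: left_diff_distrib[symmetric] norm_mult intro!: mult_mono)
    then show ?thesis unfolding eq
      by (intro order_trans[OF norm_triangle_ineq]) (simp add: norm_mult algebra_simps del: of_real_diff)
  qed
  then show ?thesis using that by blast
qed

section \<open>Existence and uniqueness for the integral equation\<close>

lemma weighted_volterra_le:
  assumes "0 < l" "s \<le> x"
  shows "(x - s) * exp (l * (s - a)) \<le> exp (l * (x - a)) / l"
proof -
  \<comment> \<open>From u <= exp u with u = l (x - s); the gain 1/l is what makes the weighted
    operator small.\<close>
  have "l * (x - s) \<le> exp (l * (x - s))" using exp_ge_add_one_self[of "l * (x - s)"] by linarith
  then have "l * (x - s) * exp (l * (s - a)) \<le> exp (l * (x - s)) * exp (l * (s - a))"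
    by (intro mult_right_mono) auto
  also have "\<dots> = exp (l * (x - a))" by (simp add: exp_add[symmetric] algebra_simps)
  finally show ?thesis using assms(1) by (simp add: field_simps)
qed

text \<open>The weight \<open>exp (l * (x - a))\<close> turns the Volterra operator into a contraction on the whole
  interval.\<close>

lemma solution_exists: "\<exists>f. solution \<alpha> \<beta> f"
proof -
  \<comment> \<open>The contraction factor is mass / l, which this choice puts below 1/2 even when
    \<open>mass\<close> is 0.\<close>
  define l where "l = 2 * mass + 1"
  have l: "0 < l" using mass_nonneg by (simp add: l_def)
  \<comment> \<open>Bounded continuous functions here live on the whole line; clamping to [a, b]
    transfers the equation to them.\<close>
  define P where "P x = max a (min b x)" for x
  have P: "P x \<in> {a..b}" "\<bar>P x - P y\<bar> \<le> \<bar>x - y\<bar>" for x y using ab by (auto simp: P_def)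
  have P_id: "P x = x" if "x \<in> {a..b}" for x using that by (auto simp: P_def)
  define W where "W x = exp (l * (P x - a))" for x
  have W: "1 \<le> W x" for x using l P(1)[of x] by (simp add: W_def)
  have contP: "continuous_on UNIV P" unfolding P_def by (intro continuous_intros)
  have contW: "continuous_on UNIV W" unfolding W_def by (intro continuous_intros contP)
  \<comment> \<open>The unknown is u = f / W, so the weighted norm of f becomes the plain supremum
    norm of u.\<close>
  define \<Phi> where "\<Phi> u x = (\<alpha> + \<beta> * of_real (P x - a) + I (\<lambda>s. volterra (P x) s * (of_real (W s) * u s))) / of_real (W x)"
    for u x
  have bm: "bdd_meas (\<lambda>s. of_real (W s) * apply_bcontfun u s)" for u :: "real \<Rightarrow>\<^sub>C complex"
    by (intro bdd_meas_mult bdd_meas_continuous continuous_intros continuous_on_subset[OF contW]) auto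
  have "continuous_on UNIV (\<Phi> (apply_bcontfun u))" for u :: "real \<Rightarrow>\<^sub>C complex"
  proof -
    obtain C where "\<forall>x\<in>{a<..<b}. cmod (of_real (W x) * apply_bcontfun u x) \<le> C"
      using bm[of u] by (auto simp: bdd_meas_def bounded_iff)
    then have C: "cmod (of_real (W x) * apply_bcontfun u x) \<le> max C 0" if "x \<in> {a<..<b}" for x
      using that by fastforce
    have "cmod (I (\<lambda>s. volterra x s * (of_real (W s) * apply_bcontfun u s))
        - I (\<lambda>s. volterra y s * (of_real (W s) * apply_bcontfun u s))) \<le> mass * (\<bar>x - y\<bar> * max C 0)" for x y
      using C volterra_lipschitz
      by (intro norm_I_diff_le bdd_meas_mult[OF bdd_meas_volterra] bm)
        (auto simp: left_diff_distrib[symmetric] norm_mult[of "volterra _ _ - _"] intro!: mult_mono)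
    then have "(mass * max C 0)-lipschitz_on UNIV (\<lambda>x. I (\<lambda>s. volterra x s * (of_real (W s) * apply_bcontfun u s)))"
      using mass_nonneg by (intro lipschitz_onI) (auto simp: dist_norm mult_ac)
    then have "continuous_on UNIV (\<lambda>x. I (\<lambda>s. volterra (P x) s * (of_real (W s) * apply_bcontfun u s)))"
      using continuous_on_compose2[OF lipschitz_on_continuous_on contP] by auto
    then show ?thesis
      unfolding \<Phi>_def using W by (intro continuous_intros contP contW) (auto simp: W_def)
  qed
  moreover have "bounded (range (\<Phi> (apply_bcontfun u)))" if "continuous_on UNIV (\<Phi> (apply_bcontfun u))" for u :: "real \<Rightarrow>\<^sub>C complex"
  proof -
    \<comment> \<open>The image is determined by its values on the compact interval, hence
      bounded.\<close>
    have "\<Phi> (apply_bcontfun u) x = \<Phi> (apply_bcontfun u) (P x)" for x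
      using P_id[OF P(1)] by (simp add: \<Phi>_def W_def)
    then have "range (\<Phi> (apply_bcontfun u)) \<subseteq> \<Phi> (apply_bcontfun u) ` {a..b}"
      using P(1) by (metis image_eqI image_subsetI)
    then show ?thesis
      using bounded_subset compact_imp_bounded compact_continuous_image[OF continuous_on_subset[OF that] compact_Icc]
      by (metis subset_UNIV)
  qed
  ultimately have \<Phi>: "\<Phi> (apply_bcontfun u) \<in> bcontfun" for u :: "real \<Rightarrow>\<^sub>C complex"
    by (simp add: bcontfun_def)
  define F where "F u = Bcontfun (\<Phi> (apply_bcontfun u))" for u :: "real \<Rightarrow>\<^sub>C complex"
  have F: "apply_bcontfun (F u) = \<Phi> (apply_bcontfun u)" for u
    unfolding F_def by (rule Bcontfun_inverse[OF \<Phi>])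
  have "dist (F u) (F v) \<le> (mass / l) * dist u v" for u v
  proof (rule dist_bound)
    fix x
    have "cmod (I (\<lambda>s. volterra (P x) s * (of_real (W s) * apply_bcontfun u s))
        - I (\<lambda>s. volterra (P x) s * (of_real (W s) * apply_bcontfun v s))) \<le> mass * (W x / l * dist u v)"
    proof (intro norm_I_diff_le bdd_meas_mult[OF bdd_meas_volterra] bm)
      fix s assume s: "s \<in> {a<..<b}"
      \<comment> \<open>The weighted kernel estimate applies with \<open>P s = s\<close>, because s
        ranges over J only.\<close>
      have "max (P x - s) 0 * W s \<le> W x / l"
      proof (cases "s \<le> P x")
        case True
        then show ?thesis using weighted_volterra_le[OF l True] P_id[of s] s by (simp add: W_def)
      next
        case False
        then show ?thesis using W[of x] l by (simp add: max_def)
      qed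
      moreover have "cmod (apply_bcontfun u s - apply_bcontfun v s) \<le> dist u v"
        using dist_bounded[of u s v] by (simp add: dist_norm)
      moreover have "cmod (volterra (P x) s * (of_real (W s) * apply_bcontfun u s) -
          volterra (P x) s * (of_real (W s) * apply_bcontfun v s))
        = (max (P x - s) 0 * W s) * cmod (apply_bcontfun u s - apply_bcontfun v s)"
      proof -
        have "volterra (P x) s * (of_real (W s) * apply_bcontfun u s) -
          volterra (P x) s * (of_real (W s) * apply_bcontfun v s)
          = of_real (max (P x - s) 0 * W s) * (apply_bcontfun u s - apply_bcontfun v s)"
          by (simp add: volterra_def algebra_simps)
        moreover have "0 \<le> max (P x - s) 0 * W s" using W[of s] by simp
        ultimately show ?thesis by (simp only: norm_mult norm_of_real abs_of_nonneg)
      qed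
      ultimately show "cmod (volterra (P x) s * (of_real (W s) * apply_bcontfun u s) -
          volterra (P x) s * (of_real (W s) * apply_bcontfun v s)) \<le> W x / l * dist u v"
        using W[of s] W[of x] l by (simp only:) (intro mult_mono; simp)
    qed (use W[of x] l in simp)
    moreover have "apply_bcontfun (F u) x - apply_bcontfun (F v) x =
      (I (\<lambda>s. volterra (P x) s * (of_real (W s) * apply_bcontfun u s))
        - I (\<lambda>s. volterra (P x) s * (of_real (W s) * apply_bcontfun v s))) / of_real (W x)"
      unfolding F \<Phi>_def by (simp add: diff_divide_distrib add_divide_distrib)
    ultimately show "dist (apply_bcontfun (F u) x) (apply_bcontfun (F v) x) \<le> (mass / l) * dist u v"
      using W[of x] by (simp add: dist_norm norm_divide divide_le_eq mult_ac)
  qed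
  moreover have "mass / l < 1" "0 \<le> mass / l" using mass_nonneg by (auto simp: l_def)
  ultimately obtain u where u: "F u = u" using banach_fix_type[of "mass / l" F] by blast
  define f where "f x = of_real (W x) * apply_bcontfun u x" for x
  have "f x = \<alpha> + \<beta> * of_real (x - a) + I (\<lambda>s. volterra x s * f s)" if "x \<in> {a..b}" for x
  proof -
    have "f x = of_real (W x) * \<Phi> (apply_bcontfun u) x" unfolding f_def F[symmetric] u ..
    then show ?thesis using W[of x] P_id[OF that] by (simp add: \<Phi>_def f_def)
  qed
  moreover have "continuous_on {a..b} f"
    unfolding f_def by (intro continuous_intros continuous_on_subset[OF contW]) auto
  ultimately show ?thesis by (auto simp: solution_def)
qed

text \<open>With vanishing data at \<open>x\<^sub>0\<close>, the equation can be read backwards from \<open>x\<^sub>0\<close>; evaluated where the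
  weighted modulus \<open>cmod (f x) * exp (l * (x - x\<^sub>0))\<close> is maximal, it forces \<open>f = 0\<close> on \<open>{a..x\<^sub>0}\<close>.\<close>

lemma solution_Cauchy_data:
  assumes f: "solution \<alpha> \<beta> f" and x0: "x\<^sub>0 \<in> {a..b}"
    and f0: "f x\<^sub>0 = 0" and g0: "quasi_deriv \<beta> f x\<^sub>0 = 0"
  shows "\<alpha> = 0 \<and> \<beta> = 0"
proof -
  have fb: "bdd_meas f" by (rule solution_bdd[OF f])
  have fc: "continuous_on {a..b} f" using f by (simp add: solution_def)
  have f_eq: "f x = \<alpha> + \<beta> * of_real (x - a) + I (\<lambda>s. volterra x s * f s)" if "x \<in> {a..b}" for x
    using f that unfolding solution_def by blast
  \<comment> \<open>Expanding f about \<open>x\<^sub>0\<close> instead of a replaces the kernel by s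
    - x on x < s < \<open>x\<^sub>0\<close>. The three cases s < x, x <= s <
    \<open>x\<^sub>0\<close> and \<open>x\<^sub>0\<close> <= s verify the identity that
    follows.\<close>
  define k where "k x s = (if x < s \<and> s < x\<^sub>0 then s - x else 0)" for x s
  have k: "of_real (k x s) = volterra x s - volterra x\<^sub>0 s + of_real (x\<^sub>0 - x) * of_bool (s < x\<^sub>0)" if "x \<le> x\<^sub>0" for x s
    using that unfolding volterra_def k_def by (auto simp: max_def)
  have bk: "bdd_meas (\<lambda>s. of_real (k x s))" if "x \<le> x\<^sub>0" for x
  proof -
    have "bdd_meas (\<lambda>s. volterra x s + (-1) * volterra x\<^sub>0 s + of_real (x\<^sub>0 - x) * of_bool (s < x\<^sub>0))"
      by (intro bdd_meas_add bdd_meas_mult bdd_meas_volterra bdd_meas_const bdd_meas_less)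
    then show ?thesis using k[OF that] by simp
  qed
  have bwd: "f x = I (\<lambda>s. of_real (k x s) * f s)" if "x \<in> {a..x\<^sub>0}" for x
  proof -
    have x: "x \<in> {a..b}" "x \<le> x\<^sub>0" using that x0 by auto
    have "I (\<lambda>s. of_real (k x s) * f s) =
        I (\<lambda>s. (volterra x s * f s - volterra x\<^sub>0 s * f s) + of_real (x\<^sub>0 - x) * (of_bool (s < x\<^sub>0) * f s))"
      unfolding k[OF x(2)] by (simp add: algebra_simps)
    also have "\<dots> = (I (\<lambda>s. volterra x s * f s) - I (\<lambda>s. volterra x\<^sub>0 s * f s))
        + of_real (x\<^sub>0 - x) * I (\<lambda>s. of_bool (s < x\<^sub>0) * f s)"
    proof -
      have b: "bdd_meas (\<lambda>s. volterra y s * f s)" for y by (intro bdd_meas_mult bdd_meas_volterra fb)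
      have "bdd_meas (\<lambda>s. volterra x s * f s + (-1) * (volterra x\<^sub>0 s * f s))"
        by (intro bdd_meas_add bdd_meas_mult bdd_meas_const b bdd_meas_volterra fb)
      then have "bdd_meas (\<lambda>s. volterra x s * f s - volterra x\<^sub>0 s * f s)" by simp
      then show ?thesis
        using I_diff[OF b b] by (subst I_add) (auto simp: I_cmult intro!: bdd_meas_mult bdd_meas_const bdd_meas_less fb)
    qed
    also have "\<dots> = f x - f x\<^sub>0 + of_real (x\<^sub>0 - x) * quasi_deriv \<beta> f x\<^sub>0"
      unfolding f_eq[OF x(1)] f_eq[OF x0] quasi_deriv_def by (simp add: algebra_simps)
    finally show ?thesis using f0 g0 by simp
  qed
  \<comment> \<open>At a maximum point z the estimate becomes |f z| <= (mass / l) |f z|, with a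
    factor below 1/2.\<close>
  define l where "l = 2 * mass + 1"
  have l: "0 < l" using mass_nonneg by (simp add: l_def)
  define h where "h x = cmod (f x) * exp (l * (x - x\<^sub>0))" for x
  have "continuous_on {a..x\<^sub>0} h"
    unfolding h_def using x0 by (intro continuous_intros continuous_on_subset[OF fc]) auto
  then obtain z where z: "z \<in> {a..x\<^sub>0}" "\<And>x. x \<in> {a..x\<^sub>0} \<Longrightarrow> h x \<le> h z"
    using continuous_attains_sup[of "{a..x\<^sub>0}" h] x0 by auto
  have "cmod (I (\<lambda>s. of_real (k z s) * f s)) \<le> mass * (exp (l * (x\<^sub>0 - z)) / l * h z)"
  proof (rule norm_I_le)
    show "0 \<le> exp (l * (x\<^sub>0 - z)) / l * h z" using l by (simp add: h_def)
    fix s assume s: "s \<in> {a<..<b}"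
    show "cmod (of_real (k z s) * f s) \<le> exp (l * (x\<^sub>0 - z)) / l * h z"
    proof (cases "z < s \<and> s < x\<^sub>0")
      case True
      have "l * (s - z) \<le> exp (l * (s - z))" using exp_ge_add_one_self[of "l * (s - z)"] by linarith
      then have "s - z \<le> exp (l * (s - z)) / l" using l by (simp add: field_simps)
      moreover have "cmod (f s) = exp (l * (x\<^sub>0 - s)) * h s"
        by (simp add: h_def exp_add[symmetric] algebra_simps)
      moreover have "h s \<le> h z" using z(2) s True by auto
      moreover have "0 \<le> h s" by (simp add: h_def)
      ultimately have "(s - z) * cmod (f s) \<le> exp (l * (s - z)) / l * (exp (l * (x\<^sub>0 - s)) * h z)"
        using True l by (intro mult_mono) auto
      also have "\<dots> = exp (l * (x\<^sub>0 - z)) / l * h z"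
      proof -
        have "exp (l * (s - z)) * exp (l * (x\<^sub>0 - s)) = exp (l * (x\<^sub>0 - z))"
          by (simp add: exp_add[symmetric] algebra_simps)
        then show ?thesis by (simp flip: mult.assoc)
      qed
      finally show ?thesis using True by (simp add: k_def norm_mult del: of_real_diff)
    next
      case False
      then have "k z s = 0" unfolding k_def by simp
      then show ?thesis using l by (simp add: h_def)
    qed
  qed
  then have "cmod (f z) \<le> mass / l * (exp (l * (x\<^sub>0 - z)) * h z)"
    using bwd[OF z(1)] by simp
  also have "exp (l * (x\<^sub>0 - z)) * h z = cmod (f z)"
  proof -
    have "exp (l * (x\<^sub>0 - z)) * exp (l * (z - x\<^sub>0)) = 1" by (simp add: exp_add[symmetric] algebra_simps)
    then show ?thesis by (simp add: h_def)
  qed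
  finally have "(1 - mass / l) * cmod (f z) \<le> 0" by (simp add: algebra_simps)
  moreover have "0 < 1 - mass / l" using mass_nonneg by (simp add: l_def)
  ultimately have "f z = 0" by (simp add: mult_le_0_iff)
  then have f_zero: "f x = 0" if "x \<in> {a..x\<^sub>0}" for x
    using z(2)[OF that] by (simp add: h_def mult_le_0_iff)
  \<comment> \<open>The quasi-derivative at \<open>x\<^sub>0\<close> sees f only on the left, where
    it vanishes, so it reduces to \<beta>. Likewise f(a) reduces to \<alpha>.\<close>
  have "I (\<lambda>s. of_bool (s < x\<^sub>0) * f s) = I (\<lambda>s. 0 * 0)"
    by (rule I_cong) (use f_zero in auto)
  then have "\<beta> = 0" using g0 by (simp add: quasi_deriv_def I_cmult I_def)
  moreover have "I (\<lambda>s. volterra a s * f s) = I (\<lambda>s. 0)"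
    by (rule I_cong) (auto simp: volterra_def)
  then have "\<alpha> = 0" using f_eq[of a] f_zero[of a] ab x0 by (simp add: I_def)
  ultimately show ?thesis by simp
qed

section \<open>Solutions without zeros\<close>

lemma solution_pair_no_common_zero:
  assumes f: "solution 1 0 f" and g: "solution 0 1 g" and x: "x \<in> {a..b}" "g x = 0"
  shows "f x \<noteq> 0"
proof
  assume "f x = 0"
  let ?p = "quasi_deriv 0 f x" and ?q = "quasi_deriv 1 g x"
  \<comment> \<open>At a common zero x, this condition makes all Cauchy data of z f + w g at x
    vanish, while z and w are its data at a.\<close>
  have *: "z = 0 \<and> w = 0" if "z * ?p + w * ?q = 0" for z w
    using solution_Cauchy_data[OF solution_lincomb(1)[OF f g, of z w] x(1)]
      solution_lincomb(2)[OF f g, of z w x] \<open>f x = 0\<close> x(2) that by simp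
  \<comment> \<open>Take z = \<open>?q\<close>, w = - \<open>?p\<close>. Both quasi-derivatives are
    then 0, so z = 1, w = 0 meets the condition as well, a contradiction.\<close>
  have "?q = 0 \<and> - ?p = 0" by (rule *) simp
  then show False using *[of 1 0] by simp
qed

lemma nonvanishing_solution: "\<exists>\<beta> f. solution 1 \<beta> f \<and> (\<forall>x\<in>{a..b}. f x \<noteq> 0)"
proof -
  obtain f g where f: "solution 1 0 f" and g: "solution 0 1 g" using solution_exists by blast
  obtain A where A: "\<And>x y. x \<in> {a..b} \<Longrightarrow> y \<in> {a..b} \<Longrightarrow> cmod (f x - f y) \<le> A * \<bar>x - y\<bar>"
    using solution_lipschitz[OF f] by blast
  obtain B where B: "\<And>x y. x \<in> {a..b} \<Longrightarrow> y \<in> {a..b} \<Longrightarrow> cmod (g x - g y) \<le> B * \<bar>x - y\<bar>"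
    using solution_lipschitz[OF g] by blast
  \<comment> \<open>The interval is placed on the real axis of the plane, a null set, because the
    Lipschitz image theorem compares spaces of equal dimension here.\<close>
  define S where "S = {w :: complex. Im w = 0 \<and> Re w \<in> {a..b} \<and> g (Re w) \<noteq> 0}"
  define r where "r w = - f (Re w) / g (Re w)" for w :: complex
  have "negligible {w :: complex. \<i> \<bullet> w = 0}" by (rule negligible_hyperplane) simp
  then have S: "negligible S" by (rule negligible_subset) (auto simp: S_def inner_complex_def)
  have "negligible (r ` S)"
  proof (rule negligible_locally_Lipschitz_image[OF _ S])
    fix w assume w: "w \<in> S"
    let ?x = "Re w" let ?e = "cmod (g ?x) / 2"
    have gx: "g ?x \<noteq> 0" and x: "?x \<in> {a..b}" using w by (auto simp: S_def)
    have B0: "0 \<le> B" using B[of a b] ab by (smt (verit) atLeastAtMost_iff mult_less_0_iff norm_ge_zero)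
    \<comment> \<open>Within this radius g changes by less than half of |g(x)|, so |g| stays at
      least \<open>?e\<close>. The summand 1 keeps the denominator positive when B is 0.\<close>
    define T where "T = ball w (?e / (B + 1))"
    \<comment> \<open>The quotient rule for Lipschitz functions, with the denominator bounded below
      on \<open>T\<close>.\<close>
    define C where "C = (A * cmod (g ?x) + cmod (f ?x) * B) / (?e * cmod (g ?x))"
    have T: "open T" "w \<in> T" using gx B0 by (auto simp: T_def)
    have "cmod (r v - r w) \<le> C * cmod (v - w)" if v: "v \<in> S \<inter> T" for v
    proof -
      let ?y = "Re v"
      have y: "?y \<in> {a..b}" "g ?y \<noteq> 0" using v by (auto simp: S_def)
      have yx: "\<bar>?y - ?x\<bar> \<le> cmod (v - w)" using abs_Re_le_cmod[of "v - w"] by simp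
      have "cmod (v - w) < ?e / (B + 1)" using v by (simp add: T_def dist_norm norm_minus_commute)
      then have "(B + 1) * cmod (v - w) < ?e" using B0 by (simp add: field_simps)
      moreover have "cmod (g ?y - g ?x) \<le> B * cmod (v - w)"
        using B[OF y(1) x] yx B0 by (meson mult_left_mono order_trans)
      moreover have "B * cmod (v - w) \<le> (B + 1) * cmod (v - w)" by (intro mult_right_mono) auto
      ultimately have gy: "?e \<le> cmod (g ?y)"
        using norm_triangle_ineq2[of "g ?x" "g ?y"] by (simp add: norm_minus_commute)
      have A0: "0 \<le> A" using A[of a b] ab by (smt (verit) atLeastAtMost_iff mult_less_0_iff norm_ge_zero)
      have "r v - r w = ((f ?x - f ?y) * g ?x + f ?x * (g ?y - g ?x)) / (g ?y * g ?x)"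
        using gx y(2) by (simp add: r_def field_simps)
      then have "cmod (r v - r w) = cmod ((f ?x - f ?y) * g ?x + f ?x * (g ?y - g ?x)) / (cmod (g ?y) * cmod (g ?x))"
        by (simp add: norm_divide norm_mult)
      also have "\<dots> \<le> ((A * cmod (g ?x) + cmod (f ?x) * B) * cmod (v - w)) / (?e * cmod (g ?x))"
      proof (rule frac_le)
        have "cmod ((f ?x - f ?y) * g ?x + f ?x * (g ?y - g ?x))
          \<le> (A * cmod (v - w)) * cmod (g ?x) + cmod (f ?x) * (B * cmod (v - w))"
        proof (rule order_trans[OF norm_triangle_ineq], unfold norm_mult, intro add_mono mult_right_mono mult_left_mono)
          have "\<bar>?x - ?y\<bar> \<le> cmod (v - w)" using yx by simp
          then show "cmod (f ?x - f ?y) \<le> A * cmod (v - w)"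
            using A[OF x y(1)] A0 by (meson mult_left_mono order_trans)
          show "cmod (g ?y - g ?x) \<le> B * cmod (v - w)" by fact
        qed auto
        then show "cmod ((f ?x - f ?y) * g ?x + f ?x * (g ?y - g ?x))
          \<le> (A * cmod (g ?x) + cmod (f ?x) * B) * cmod (v - w)" by (simp add: algebra_simps)
        show "0 \<le> (A * cmod (g ?x) + cmod (f ?x) * B) * cmod (v - w)" using A0 B0 by simp
        show "0 < ?e * cmod (g ?x)" using gx by simp
        show "?e * cmod (g ?x) \<le> cmod (g ?y) * cmod (g ?x)" using gy by (intro mult_right_mono) auto
      qed
      finally show ?thesis unfolding C_def by (simp only: times_divide_eq_left)
    qed
    then show "\<exists>T C. open T \<and> w \<in> T \<and> (\<forall>v\<in>S \<inter> T. cmod (r v - r w) \<le> C * cmod (v - w))"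
      using T by blast
  qed simp
  then have "r ` S \<noteq> UNIV" using non_negligible_UNIV by metis
  then obtain \<beta> where \<beta>: "\<beta> \<notin> r ` S" by blast
  have "solution 1 \<beta> (\<lambda>x. f x + \<beta> * g x)"
    using solution_lincomb(1)[OF f g, of 1 \<beta>] by simp
  moreover have "f x + \<beta> * g x \<noteq> 0" if x: "x \<in> {a..b}" for x
  proof (cases "g x = 0")
    case True
    then show ?thesis using solution_pair_no_common_zero[OF f g x] by simp
  next
    case False
    then have "of_real x \<in> S" using x by (simp add: S_def)
    then have "\<beta> \<noteq> - f x / g x" using \<beta> by (metis Re_complex_of_real image_eqI r_def)
    then show ?thesis using False by (simp add: field_simps eq_neg_iff_add_eq_0 add.commute)
  qed
  ultimately show ?thesis by blast
qed

end

section \<open>Admissibility\<close>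

context measure_combination
begin

interpretation L: finite_measure "lebesgue_on {a<..<b}"
  by (rule finite_measure_lebesgue_on) simp

section \<open>From the integral equation to the weak equation\<close>

lemma quasi_deriv_eq_sum:
  "quasi_deriv \<beta> f t = \<beta> + (\<Sum>k<m. c k * (LINT s|N k. of_bool (s < t) * f s))"
  by (simp add: quasi_deriv_def I_def)

lemma quasi_deriv_L2:
  assumes f: "bdd_meas f"
  shows "quasi_deriv \<beta> f \<in> L2 {a<..<b}"
proof -
  have "(\<lambda>t. LINT s|N k. of_bool (s < t) * f s) \<in> borel_measurable (lebesgue_on {a<..<b})" for k
  proof -
    interpret finite_measure "N k" by (rule fin)
    have [measurable]: "f \<in> borel_measurable (N k)" using f by (simp add: bdd_meas_def)
    note [measurable] = idN id_measurable_lebesgue_on[of "{a<..<b}"]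
    have "(\<lambda>(t, s). of_bool (s < t) * f s) \<in> borel_measurable (lebesgue_on {a<..<b} \<Otimes>\<^sub>M N k)"
      by measurable
    then show ?thesis by (rule borel_measurable_lebesgue_integral)
  qed
  note [measurable] = this
  have meas: "quasi_deriv \<beta> f \<in> borel_measurable (lebesgue_on {a<..<b})"
    unfolding quasi_deriv_eq_sum by measurable
  obtain C where "\<forall>x\<in>{a<..<b}. cmod (f x) \<le> C"
    using f by (auto simp: bdd_meas_def bounded_iff)
  then have C: "cmod (f x) \<le> max C 0" if "x \<in> {a<..<b}" for x using that by fastforce
  have "cmod (quasi_deriv \<beta> f t) \<le> cmod \<beta> + mass * max C 0" for t
    unfolding quasi_deriv_def
    by (rule order_trans[OF norm_triangle_ineq], rule add_left_mono, rule norm_I_le)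
      (use C in \<open>auto simp: norm_mult\<close>)
  then show ?thesis by (intro L2_bounded(1)[OF ab meas]) auto
qed

lemma integral_between:
  assumes "s \<in> {a..b}" "x \<in> {a..b}"
  shows "(LINT t|lebesgue_on {a<..<b}. of_bool (s < t) * of_bool (t < x)) = volterra x s"
proof -
  have "(LINT t|lebesgue_on {a<..<b}. of_bool (s < t) * of_bool (t < x))
      = (LINT t|lebesgue_on {a<..<b}. complex_of_real (indicator {s<..<x} t))"
    by (intro Bochner_Integration.integral_cong) (auto simp: indicator_def)
  also have "\<dots> = of_real (measure (lebesgue_on {a<..<b}) ({s<..<x} \<inter> {a<..<b}))"
    by simp
  also have "{s<..<x} \<inter> {a<..<b} = {s<..<x}" using assms by auto
  also have "measure (lebesgue_on {a<..<b}) {s<..<x} = measure lebesgue {s<..<x}"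
    using assms by (intro measure_restrict_space) auto
  also have "\<dots> = max (x - s) 0" by (simp add: max_def)
  finally show ?thesis by (simp add: volterra_def)
qed

text \<open>Exchanging integrals, the primitive of the mass of f \<mu> left of t is the integral of
  the Volterra kernel against f \<mu>. So the quasi-derivative is a weak derivative of f, regardless
  of atoms.\<close>

lemma solution_eq_prim:
  assumes f: "solution \<alpha> \<beta> f" and x: "x \<in> {a..b}"
  shows "f x = \<alpha> + prim {a<..<b} (quasi_deriv \<beta> f) x"
proof -
  let ?L = "lebesgue_on {a<..<b}"
  note fb = solution_bdd[OF f]
  let ?h = "\<lambda>t. of_bool (t < x) * 1 :: complex"
  have h: "integrable ?L ?h" by (rule prim_integrable[OF ab]) simp
  note F = Fubini_triangle[OF L.finite_measure_axioms fin id_measurable_lebesgue_on idN h bdd_meas_integrable[OF fb]]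
  have inner: "(LINT t|?L. ?h t * (LINT s|N k. of_bool (s < t) * f s)) = (LINT s|N k. volterra x s * f s)" for k
    unfolding F(1)
    by (intro Bochner_Integration.integral_cong) (use x integral_between in \<open>auto simp: space\<close>)
  have "prim {a<..<b} (quasi_deriv \<beta> f) x
      = (LINT t|?L. \<beta> * ?h t + (\<Sum>k<m. c k * (?h t * (LINT s|N k. of_bool (s < t) * f s))))"
    unfolding prim_def quasi_deriv_eq_sum
    by (intro Bochner_Integration.integral_cong) (auto simp: algebra_simps sum_distrib_left)
  also have "\<dots> = \<beta> * integral\<^sup>L ?L ?h + (\<Sum>k<m. c k * (LINT t|?L. ?h t * (LINT s|N k. of_bool (s < t) * f s)))"
    using h F(2) by simp
  also have "integral\<^sup>L ?L ?h = (LINT t|?L. of_bool (a < t) * of_bool (t < x))"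
    by (intro Bochner_Integration.integral_cong) auto
  also have "\<dots> = of_real (x - a)"
    using integral_between[of a x] x ab by (simp add: volterra_def max_def)
  also have "(\<Sum>k<m. c k * (LINT t|?L. ?h t * (LINT s|N k. of_bool (s < t) * f s))) = I (\<lambda>s. volterra x s * f s)"
    unfolding inner I_def ..
  finally show ?thesis using f x by (simp add: solution_def add.assoc)
qed

text \<open>Each s is paired with the integral of \<phi>' beyond s, which is -\<phi>(s). The
  constant \<beta> contributes nothing, as \<phi>' has mean zero.\<close>

lemma solution_weak_equation:
  assumes f: "solution \<alpha> \<beta> f" and \<phi>: "\<phi> \<in> W12_0 {a<..<b}"
  shows "(LINT t|lebesgue_on {a<..<b}. quasi_deriv \<beta> f t * weak_deriv {a<..<b} \<phi> t) = - I (\<lambda>s. f s * \<phi> s)"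
proof -
  let ?L = "lebesgue_on {a<..<b}" let ?G = "weak_deriv {a<..<b} \<phi>"
  note fb = solution_bdd[OF f]
  note \<phi>D = W12_0D[OF ab \<phi>]
  have G: "integrable ?L ?G" by (rule L2_integrable[OF ab \<phi>D(1)])
  note F = Fubini_triangle[OF L.finite_measure_axioms fin id_measurable_lebesgue_on idN G bdd_meas_integrable[OF fb]]
  have inner: "(LINT t|?L. ?G t * (LINT s|N k. of_bool (s < t) * f s)) = - (LINT s|N k. f s * \<phi> s)" for k
  proof -
    have "(LINT s|N k. f s * (LINT t|?L. of_bool (s < t) * ?G t)) = (LINT s|N k. - (f s * \<phi> s))"
      by (intro Bochner_Integration.integral_cong)
        (auto simp: space integral_upper[OF ab G] \<phi>D(2) \<phi>D(3)[symmetric])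
    then show ?thesis unfolding F(1) by simp
  qed
  have "(LINT t|?L. quasi_deriv \<beta> f t * ?G t)
      = (LINT t|?L. \<beta> * ?G t + (\<Sum>k<m. c k * (?G t * (LINT s|N k. of_bool (s < t) * f s))))"
    unfolding quasi_deriv_eq_sum
    by (intro Bochner_Integration.integral_cong) (auto simp: algebra_simps sum_distrib_left)
  also have "\<dots> = \<beta> * integral\<^sup>L ?L ?G + (\<Sum>k<m. c k * (LINT t|?L. ?G t * (LINT s|N k. of_bool (s < t) * f s)))"
    using G F(2) by simp
  also have "\<dots> = - I (\<lambda>s. f s * \<phi> s)"
    unfolding inner I_def by (simp add: \<phi>D(2) sum_negf)
  finally show ?thesis .
qed

theorem admissible_if_measure_combination:
  assumes q: "\<And>\<phi>. \<phi> \<in> W12_0 {a<..<b} \<Longrightarrow> q \<phi> = I \<phi>"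
  shows "admissible {a<..<b} q"
proof -
  let ?J = "{a<..<b}"
  have bdd: "bdd_meas \<phi>" if "\<phi> \<in> W12_0 ?J" for \<phi>
    by (rule bdd_meas_continuous[OF W12_0_continuous[OF ab that]])
  have dual: "q \<in> W12_dual ?J"
    unfolding W12_dual_def mem_Collect_eq
  proof (intro conjI ballI allI exI)
    fix \<phi> \<psi> assume "\<phi> \<in> W12_0 ?J" "\<psi> \<in> W12_0 ?J"
    then show "q (\<lambda>x. \<phi> x + \<psi> x) = q \<phi> + q \<psi>"
      by (simp add: q W12_0_add[OF ab] I_add bdd)
  next
    fix z \<phi> assume "\<phi> \<in> W12_0 ?J"
    then show "q (\<lambda>x. z * \<phi> x) = z * q \<phi>"
      by (simp add: q W12_0_cmult[OF ab] I_cmult)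
  next
    fix \<phi> assume \<phi>: "\<phi> \<in> W12_0 ?J"
    have "cmod (I \<phi>) \<le> mass * (sqrt (b - a) * W12_norm ?J \<phi>)"
      using W12_0_bound[OF ab \<phi>] ab
      by (intro norm_I_le) (auto simp: W12_norm_eq sqint_nonneg)
    then show "cmod (q \<phi>) \<le> mass * sqrt (b - a) * W12_norm ?J \<phi>"
      by (simp add: q[OF \<phi>] mult.assoc)
  qed
  obtain \<beta> f where f: "solution 1 \<beta> f" and nz: "\<And>x. x \<in> {a..b} \<Longrightarrow> f x \<noteq> 0"
    using nonvanishing_solution by blast
  let ?g = "quasi_deriv \<beta> f"
  note g = quasi_deriv_L2[OF solution_bdd[OF f], of \<beta>]
  note prim = solution_eq_prim[OF f]
  have W: "f \<in> W12 ?J" "has_weak_deriv ?J f ?g"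
    using W12_primI[OF ab g, of f 1] prim by blast+
  note wd = weak_deriv_AE_eq[OF ab g W(2)]
  have eq: "S_op ?J q f \<phi> = 0" if \<phi>: "\<phi> \<in> W12_0 ?J" for \<phi>
  proof -
    have "(LINT x|lebesgue_on ?J. weak_deriv ?J f x * weak_deriv ?J \<phi> x)
        = (LINT x|lebesgue_on ?J. ?g x * weak_deriv ?J \<phi> x)"
    proof (rule integral_cong_AE)
      note [measurable] = L2_measurable[OF g] L2_measurable[OF wd(2)] L2_measurable[OF W12_0D(1)[OF ab \<phi>]]
      show "(\<lambda>x. weak_deriv ?J f x * weak_deriv ?J \<phi> x) \<in> borel_measurable (lebesgue_on ?J)"
        "(\<lambda>x. ?g x * weak_deriv ?J \<phi> x) \<in> borel_measurable (lebesgue_on ?J)" by measurable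
      show "AE x in lebesgue_on ?J. weak_deriv ?J f x * weak_deriv ?J \<phi> x = ?g x * weak_deriv ?J \<phi> x"
        using wd(1) by eventually_elim simp
    qed
    \<comment> \<open>Membership is what allows q (f \<phi>) to be rewritten as
      \<open>I\<close>.\<close>
    moreover have "(\<lambda>x. f x * \<phi> x) \<in> W12_0 ?J"
      using W12_0_mult[OF ab g _ \<phi>, of f 1] prim by blast
    ultimately show ?thesis
      using solution_weak_equation[OF f \<phi>] by (simp add: S_op_def q)
  qed
  \<comment> \<open>The zero function represents S_q f in the definition of
    \<open>D2\<close>.\<close>
  have "(\<lambda>x. 0) \<in> L2 ?J" by (simp add: L2_def)
  then have "f \<in> D2 ?J q"
    using W(1) eq by (auto simp: D2_def intro!: bexI[of _ "\<lambda>x. 0"])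
  then show ?thesis
    unfolding admissible_def closure_interval[OF ab] by (intro conjI dual bexI[of _ f] ballI eq nz)
qed

end

text \<open>Functions in W_0^{1,2} vanish at both ends of J, so integrating over J gives the same
  value as integrating over its closure, even if \<mu> has atoms at the endpoints.\<close>

theorem corollary33:
  fixes a b :: real and J :: "real set"
    and \<mu> :: "real set \<Rightarrow> complex" and q :: "(real \<Rightarrow> complex) \<Rightarrow> complex"
  assumes "a < b" and "J = {a<..<b}"
    and "complex_borel_measure (closure J) \<mu>"
    and "\<And>\<phi>. \<phi> \<in> W12_0 J \<Longrightarrow> q \<phi> = complex_measure_integral (closure J) \<mu> J \<phi>"
  shows "admissible J q"
proof (rule complex_measure_integral_decomposition[OF assms(3)])
  show "J \<in> sets borel" by (simp add: assms(2))
  show "J \<subseteq> closure J" by (rule closure_subset)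
  fix N :: "nat \<Rightarrow> real measure" and c
  assume N: "\<And>k. finite_measure (N k)" "\<And>k. (\<lambda>x. x) \<in> borel_measurable (N k)"
    "\<And>k. space (N k) = J" "\<And>k. cmod (c k) \<le> 1"
    and int: "\<And>\<phi>. complex_measure_integral (closure J) \<mu> J \<phi> = (\<Sum>k<4. c k * (LINT x|N k. \<phi> x))"
  interpret measure_combination a b 4 N c
    by (rule measure_combination.intro[OF assms(1) N(1,2) N(3)[unfolded assms(2)] N(4)])
  have "q \<phi> = I \<phi>" if "\<phi> \<in> W12_0 {a<..<b}" for \<phi>
    using assms(4)[of \<phi>] that int[of \<phi>] by (simp only: I_def assms(2))
  from admissible_if_measure_combination[OF this] show ?thesis
    by (simp only: assms(2))
qed

end
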